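(* Let $(A,\star,\circ,P)$ be a relative pre-Poisson algebra and $(A,\cdot,[-,-],P)$ its sub-adjacent relative Poisson algebra. Let $\{e_1,\dots,e_n\}$ be a basis of $A$ and $\{e_1^*,\dots,e_n^*\}$ be the dual basis. Let $(\tilde A,\cdot_{\tilde A},[-,-]_{\tilde A},\tilde P)$ be the unital relative Poisson algebra on $\tilde A=A\oplus\mathbb Ke$ extending $(A,\cdot,[-,-],P)$, and $\widetilde{\mathcal L_\star},\widetilde{\mathcal L_\circ}:\tilde A\to\mathrm{End}(A)$ the corresponding extensions of $\mathcal L_\star,\mathcal L_\circ$ (see context). Then $$r=\sum_{i=1}^n(e_i\otimes e_i^*-e_i^*\otimes e_i)$$ is an antisymmetric solution of the $(-\tilde P+P^* )$-RPYBE in the unital relative Poisson algebra $(\tilde A\ltimes A^*:=\tilde A\ltimes_{-\widetilde{\mathcal L_\star}^*,\widetilde{\mathcal L_\circ}^*}A^*,\ \tilde P-P^* )$. Moreover, there is a relative Poisson bialgebra $$(\tilde A\ltimes A^*,\cdot_{\tilde A\ltimes A^*},[-,-]_{\tilde A\ltimes A^*},\Delta,\delta,\tilde P-P^*,-\tilde P+P^* ),$$ where $\Delta,\delta:\tilde A\ltimes A^*\to(\tilde A\ltimes A^* )\otimes(\tilde A\ltimes A^* )$ are the linear maps $$\Delta(u)=(\mathrm{id}\otimes\mathcal L(u)-\mathcal L(u)\otimes\mathrm{id})r,\qquad \delta(u)=(\mathrm{ad}(u)\otimes\mathrm{id}+\mathrm{id}\otimes\mathrm{ad}(u))r,$$ ($\mathcal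 L,\mathrm{ad}$ being those of $\tilde A\ltimes A^*$), such that the induced relative Poisson algebra $(\tilde A\ltimes A^* )\bowtie(\tilde A\ltimes A^* )^*$ with the bilinear form $\mathcal B_d(x+a^*,y+b^* )=\langle x,b^*\rangle+\langle a^*,y\rangle$, $x,y\in\tilde A\ltimes A^*$, $a^*,b^*\in(\tilde A\ltimes A^* )^*$, is a Frobenius Jacobi algebra.
   Context: All vector spaces are finite-dimensional over an algebraically closed field $\mathbb K$ of characteristic zero. Relative Poisson algebra. $(A,\cdot,[-,-],P)$, abbreviated $(A,P)$: $(A,\cdot)$ is a commutative associative (not necessarily unital) algebra, $(A,[-,-])$ is a Lie algebra, $P:A\to A$ is a linear map that is a derivation of both $\cdot$ and $[-,-]$, and $[z,x\cdot y]=[z,x]\cdot y+x\cdot[z,y]+x\cdot y\cdot P(z)$. It is unital if $(A,\cdot)$ is unital. Jacobi algebra. A triple $(A,\cdot,[-,-])$ with $(A,\cdot)$ a unital commutative associative algebra with unit $1_A$, $(A,[-,-])$ a Lie algebra, and $[z,x\cdot y]=[z,x]\cdot y+x\cdot[z,y]+x\cdot y\cdot[1_A,z]$ for all $x,y,z$. Every unital relative Poisson algebra $(A,\cdot,[-,-],P)$ is a Jacobi algebra (then $P=[1_A,-]$). A Jacobi algebra is Frobenius if there is a nondegenerate symmetric bilinear form $\mathcal B$ on $A$ with $\mathcal B(x\cdot y,z)=\mathcal B(x,y\cdot z)$ and $\mathcal B([x,y],z)=\mathcal B(x,[y,z])$. Relative pre-Poisson algebra $(A,\star,\circ,P)$.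 $(A,\star)$ is a Zinbiel algebra, i.e. $x\star(y\star z)=(y\star x)\star z+(x\star y)\star z$; $(A,\circ)$ is a pre-Lie algebra, i.e. $(x\circ y)\circ z-x\circ(y\circ z)=(y\circ x)\circ z-y\circ(x\circ z)$; $P:A\to A$ is a linear map that is a derivation of both $\star$ and $\circ$; and for all $x,y,z$: $(x\star y+y\star x)\circ z-x\star(y\circ z)-y\star(x\circ z)+(x\star y+y\star x)\star P(z)=0$ and $y\circ(x\star z)-x\star(y\circ z)+(x\circ y-y\circ x)\star z-(x\star P(y)+P(y)\star x)\star z=0$. Its sub-adjacent relative Poisson algebra is $(A,\cdot,[-,-],P)$ with $x\cdot y=x\star y+y\star x$, $[x,y]=x\circ y-y\circ x$. $\mathcal L_\star(x)y=x\star y$, $\mathcal L_\circ(x)y=x\circ y$. Extension by a unit. For a relative Poisson algebra $(A,\cdot,[-,-],P)$, $\tilde A=A\oplus\mathbb Ke$ with $x\cdot_{\tilde A}y=x\cdot y$, $e\cdot_{\tilde A}x=x\cdot_{\tilde A}e=x$, $e\cdot_{\tilde A}e=e$, $[x,y]_{\tilde A}=[x,y]$, $[e,x]_{\tilde A}=-[x,e]_{\tilde A}=P(x)$, $[e,e]_{\tilde A}=0$, $\tilde P(x)=P(x)$, $\tilde P(e)=0$ ($x,y\in A$). The maps $\widetilde{\mathcal L_\star},\widetilde{\mathcal L_\circ}:\tilde A\to\mathrm{End}(A)$ are $\widetilde{\mathcal L_\star}(x)=\mathcal L_\star(x)$, $\widetilde{\mathcal L_\star}(e)=\mathrm{id}_A$,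 $\widetilde{\mathcal L_\circ}(x)=\mathcal L_\circ(x)$, $\widetilde{\mathcal L_\circ}(e)=P$ for $x\in A$. Notation. $\mathcal L(x)y=x\cdot y$, $\mathrm{ad}(x)y=[x,y]$ (with subscripts indicating the algebra), $\tau(x\otimes y)=y\otimes x$. For a linear map $\varphi:B\to\mathrm{End}(V)$, $\varphi^*:B\to\mathrm{End}(V^* )$ is $\langle\varphi^*(x)u^*,v\rangle=-\langle u^*,\varphi(x)v\rangle$ (with a sign). For a linear map $T:V_1\to V_2$ between vector spaces, $T^*:V_2^*\to V_1^*$ is the usual dual map (no sign). For linear maps $\phi_i$ on $V_i$, $\phi_1+\phi_2$ is $v_1+v_2\mapsto\phi_1(v_1)+\phi_2(v_2)$; so $(\tilde P-P^* )(x+a^* )=\tilde P(x)-P^*(a^* )$ on $\tilde A\oplus A^*$. The semi-direct product $\tilde A\ltimes_{-\widetilde{\mathcal L_\star}^*,\widetilde{\mathcal L_\circ}^*}A^*$ is $\tilde A\oplus A^*$ with $(x+a^* )\cdot(y+b^* )=x\cdot_{\tilde A}y-\widetilde{\mathcal L_\star}^*(x)b^*-\widetilde{\mathcal L_\star}^*(y)a^*$, $[x+a^*,y+b^*]=[x,y]_{\tilde A}+\widetilde{\mathcal L_\circ}^*(x)b^*-\widetilde{\mathcal L_\circ}^*(y)a^*$. RPYBE. For $r=\sum_ia_i\otimes b_i\in A\otimes A$ and a bilinear operation $\diamond$: $r_{12}\diamond r_{13}=\sum a_i\diamond a_j\otimes b_i\otimes b_j$, $r_{12}\diamond r_{23}=\sum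 a_i\otimes b_i\diamond a_j\otimes b_j$, $r_{13}\diamond r_{23}=\sum a_i\otimes a_j\otimes b_i\diamond b_j$. For a linear map $Q:A\to A$, $r$ is a solution of the $Q$-RPYBE in $(A,P)$ if $r_{12}\cdot r_{13}-r_{12}\cdot r_{23}+r_{13}\cdot r_{23}=0$, $[r_{12},r_{13}]+[r_{12},r_{23}]+[r_{13},r_{23}]=0$, $(P\otimes\mathrm{id}-\mathrm{id}\otimes Q)r=0$ and $(Q\otimes\mathrm{id}-\mathrm{id}\otimes P)r=0$. $r$ is antisymmetric if $r+\tau(r)=0$. A linear map $Q:A\to A$ dually represents $(A,P)$ if $x\cdot Q(y)-P(x)\cdot y-Q(x\cdot y)=0$, $[x,Q(y)]-[P(x),y]-Q([x,y])=0$, $[x,y\cdot z]+[y,z\cdot x]+[z,x\cdot y]+Q(x\cdot y\cdot z)=0$ for all $x,y,z\in A$. Relative Poisson coalgebra $(A,\Delta,\delta,Q)$. Linear maps $\Delta,\delta:A\to A\otimes A$, $Q:A\to A$ with $\tau\Delta=\Delta$, $(\mathrm{id}\otimes\Delta)\Delta=(\Delta\otimes\mathrm{id})\Delta$; $\tau\delta=-\delta$, $(\mathrm{id}+\xi+\xi^2)(\mathrm{id}\otimes\delta)\delta=0$ where $\xi(x\otimes y\otimes z)=y\otimes z\otimes x$; $\Delta Q=(Q\otimes\mathrm{id}+\mathrm{id}\otimes Q)\Delta$; $\delta Q=(Q\otimes\mathrm{id}+\mathrm{id}\otimes Q)\delta$; and $(\mathrm{id}\otimes\Delta)\delta(x)-(\delta\otimes\mathrm{id})\Delta(x)-(\tau\otimes\mathrm{id})(\mathrm{id}\otimes\delta)\Delta(x)-(Q\otimes\mathrm{id}\otimes\mathrm{id})(\Delta\otimes\mathrm{id})\Delta(x)=0$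 for all $x\in A$. Relative Poisson bialgebra $(A,\cdot,[-,-],\Delta,\delta,P,Q)$. $(A,\cdot,[-,-],P)$ is a relative Poisson algebra; $(A,\Delta,\delta,Q)$ is a relative Poisson coalgebra; $Q$ dually represents $(A,P)$; $\Delta P=(P\otimes\mathrm{id}-\mathrm{id}\otimes Q)\Delta$, $\delta P=(P\otimes\mathrm{id}-\mathrm{id}\otimes Q)\delta$, $(\Delta\otimes\mathrm{id})\Delta(P+Q)=0$; and for all $x,y\in A$: $\Delta(x\cdot y)=(\mathcal L(x)\otimes\mathrm{id})\Delta(y)+(\mathrm{id}\otimes\mathcal L(y))\Delta(x)$; $\delta([x,y])=(\mathrm{ad}(x)\otimes\mathrm{id}+\mathrm{id}\otimes\mathrm{ad}(x))\delta(y)-(\mathrm{ad}(y)\otimes\mathrm{id}+\mathrm{id}\otimes\mathrm{ad}(y))\delta(x)$; $\delta(x\cdot y)-(\mathrm{id}\otimes\mathrm{ad}(y))\Delta(x)-(\mathcal L(x)\otimes\mathrm{id})\delta(y)-(\mathrm{id}\otimes\mathrm{ad}(x))\Delta(y)-(\mathcal L(y)\otimes\mathrm{id})\delta(x)-(\mathrm{id}\otimes Q)\Delta(x\cdot y)=0$; $\Delta([x,y])-(\mathcal L(y)\otimes\mathrm{id})\delta(x)-(\mathrm{id}\otimes\mathrm{ad}(x))\Delta(y)+(\mathrm{id}\otimes\mathcal L(y))\delta(x)-(\mathrm{ad}(x)\otimes\mathrm{id})\Delta(y)+\Delta(P(x)\cdot y)=0$. Induced relative Poisson algebra. For a relative Poisson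 bialgebra, $A^*$ is a relative Poisson algebra with $a^*\cdot_{A^*}b^*=\Delta^*(a^*\otimes b^* )$, $[a^*,b^*]_{A^*}=\delta^*(a^*\otimes b^* )$ and derivation $Q^*$. The induced relative Poisson algebra $A\bowtie A^*$ is $A\oplus A^*$ with $(x+a^* )\cdot(y+b^* )=x\cdot_Ay-\mathcal L_{A^*}^*(a^* )y-\mathcal L_{A^*}^*(b^* )x+a^*\cdot_{A^*}b^*-\mathcal L_A^*(x)b^*-\mathcal L_A^*(y)a^*$, $[x+a^*,y+b^*]=[x,y]_A+\mathrm{ad}_{A^*}^*(a^* )y-\mathrm{ad}_{A^*}^*(b^* )x+[a^*,b^*]_{A^*}+\mathrm{ad}_A^*(x)b^*-\mathrm{ad}_A^*(y)a^*$, and derivation $P+Q^*$. *)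

theory Defs
  imports
    "HOL-Computational_Algebra.Polynomial"
    "HOL-Library.Function_Algebras"
    "HOL-Library.Product_Plus"
begin

text \<open>
  A vector space is given by a carrier inside an ambient additive group; addition is that of the
  type (pointwise on functions and pairs). Operations are only constrained on the carrier.
\<close>

record ('k, 'v) vsp =
  scl :: "'k \<Rightarrow> 'v \<Rightarrow> 'v"
  car :: "'v set"

locale fd_space =
  fixes V :: "('k::field, 'v::ab_group_add, 'm) vsp_scheme"
  assumes ambient: "vector_space (scl V)"
    and subspace_car: "module.subspace (scl V) (car V)"
    and fin_dim: "\<exists>B. finite B \<and> module.span (scl V) B = car V"

definition lin_map ::
  "('k, 'v::plus, 'm) vsp_scheme \<Rightarrow> ('k, 'w::plus, 'n) vsp_scheme \<Rightarrow> ('v \<Rightarrow> 'w) \<Rightarrow> bool" where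
  "lin_map V W T \<longleftrightarrow>
     (\<forall>x\<in>car V. T x \<in> car W) \<and>
     (\<forall>x\<in>car V. \<forall>y\<in>car V. T (x + y) = T x + T y) \<and>
     (\<forall>c. \<forall>x\<in>car V. T (scl V c x) = scl W c (T x))"

definition bilin_map ::
  "('k, 'v::plus, 'm) vsp_scheme \<Rightarrow> ('k, 'w::plus, 'n) vsp_scheme \<Rightarrow> ('v \<Rightarrow> 'v \<Rightarrow> 'w) \<Rightarrow> bool" where
  "bilin_map V W b \<longleftrightarrow>
     (\<forall>x\<in>car V. lin_map V W (\<lambda>y. b x y)) \<and> (\<forall>y\<in>car V. lin_map V W (\<lambda>x. b x y))"

definition ground :: "('k::times, 'k) vsp" where
  "ground = \<lparr>scl = (*), car = UNIV\<rparr>"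

text \<open>Functionals are extended by zero off the carrier, so that equal functionals are equal functions.\<close>

definition restr :: "('k, 'v, 'm) vsp_scheme \<Rightarrow> ('v \<Rightarrow> 'k::zero) \<Rightarrow> 'v \<Rightarrow> 'k" where
  "restr V f = (\<lambda>x. if x \<in> car V then f x else 0)"

definition dualsp :: "('k::field, 'v::ab_group_add, 'm) vsp_scheme \<Rightarrow> ('k, 'v \<Rightarrow> 'k) vsp" where
  "dualsp V = \<lparr>scl = (\<lambda>c f x. c * f x),
               car = {f. lin_map V ground f \<and> (\<forall>x. x \<notin> car V \<longrightarrow> f x = 0)}\<rparr>"

text \<open>The unsigned dual \<open>T\<^sup>*\<close> of a linear map \<open>T\<close> with domain \<open>V\<close>.\<close>

definition dual_map ::
  "('k::field, 'v, 'm) vsp_scheme \<Rightarrow> ('v \<Rightarrow> 'w) \<Rightarrow> ('w \<Rightarrow> 'k) \<Rightarrow> 'v \<Rightarrow> 'k" where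
  "dual_map V T u = restr V (\<lambda>x. u (T x))"

text \<open>For \<open>\<phi> : B \<rightarrow> End(V)\<close>, the signed map \<open>\<phi>\<^sup>* : B \<rightarrow> End(V\<^sup>*)\<close>.\<close>

definition dual_rep ::
  "('k::field, 'v, 'm) vsp_scheme \<Rightarrow> ('b \<Rightarrow> 'v \<Rightarrow> 'v) \<Rightarrow> 'b \<Rightarrow> ('v \<Rightarrow> 'k) \<Rightarrow> 'v \<Rightarrow> 'k" where
  "dual_rep V \<phi> x u = restr V (\<lambda>v. - u (\<phi> x v))"

text \<open>The canonical map \<open>V \<rightarrow> V\<^sup>*\<^sup>*\<close> and its inverse, by which \<open>V\<^sup>*\<^sup>*\<close> is identified with \<open>V\<close>.\<close>

definition ev ::
  "('k::field, 'v::ab_group_add, 'm) vsp_scheme \<Rightarrow> 'v \<Rightarrow> ('v \<Rightarrow> 'k) \<Rightarrow> 'k" where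
  "ev V x = restr (dualsp V) (\<lambda>f. f x)"

definition unev ::
  "('k::field, 'v::ab_group_add, 'm) vsp_scheme \<Rightarrow> (('v \<Rightarrow> 'k) \<Rightarrow> 'k) \<Rightarrow> 'v" where
  "unev V F = (THE x. x \<in> car V \<and> ev V x = F)"


section \<open>Tensors\<close>

text \<open>
  For finite-dimensional \<open>V\<close>, the space \<open>V \<otimes> V\<close> is realised inside the bilinear forms on \<open>V\<^sup>*\<close>,
  with \<open>x \<otimes> y\<close> the form sending \<open>(f, g)\<close> to \<open>f(x) g(y)\<close>, as the span of the pure tensors; likewise
  \<open>V \<otimes> V \<otimes> V\<close> by trilinear forms. Off the dual space all forms are zero, so that equality of
  tensors is equality of functions. The lemmas below give the effect of each operation on
  (sums of) pure tensors.
\<close>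

type_synonym ('k, 'v) tensor2 = "('v \<Rightarrow> 'k) \<Rightarrow> ('v \<Rightarrow> 'k) \<Rightarrow> 'k"
type_synonym ('k, 'v) tensor3 = "('v \<Rightarrow> 'k) \<Rightarrow> ('v \<Rightarrow> 'k) \<Rightarrow> ('v \<Rightarrow> 'k) \<Rightarrow> 'k"

definition ext2 ::
  "('k::field, 'v::ab_group_add, 'm) vsp_scheme \<Rightarrow> ('k, 'v) tensor2 \<Rightarrow> ('k, 'v) tensor2" where
  "ext2 V t = (\<lambda>f g. if f \<in> car (dualsp V) \<and> g \<in> car (dualsp V) then t f g else 0)"

definition ext3 ::
  "('k::field, 'v::ab_group_add, 'm) vsp_scheme \<Rightarrow> ('k, 'v) tensor3 \<Rightarrow> ('k, 'v) tensor3" where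
  "ext3 V t = (\<lambda>f g h. if f \<in> car (dualsp V) \<and> g \<in> car (dualsp V) \<and> h \<in> car (dualsp V)
                       then t f g h else 0)"

definition pure2 ::
  "('k::field, 'v::ab_group_add, 'm) vsp_scheme \<Rightarrow> 'v \<Rightarrow> 'v \<Rightarrow> ('k, 'v) tensor2" where
  "pure2 V x y = ext2 V (\<lambda>f g. f x * g y)"

definition pure3 ::
  "('k::field, 'v::ab_group_add, 'm) vsp_scheme \<Rightarrow> 'v \<Rightarrow> 'v \<Rightarrow> 'v \<Rightarrow> ('k, 'v) tensor3" where
  "pure3 V x y z = ext3 V (\<lambda>f g h. f x * g y * h z)"

definition scl2 :: "'k::times \<Rightarrow> ('k, 'v) tensor2 \<Rightarrow> ('k, 'v) tensor2" where
  "scl2 c t = (\<lambda>f g. c * t f g)"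

definition tensor2 ::
  "('k::field, 'v::ab_group_add, 'm) vsp_scheme \<Rightarrow> ('k, ('k, 'v) tensor2) vsp" where
  "tensor2 V = \<lparr>scl = scl2,
                car = module.span scl2 {pure2 V x y | x y. x \<in> car V \<and> y \<in> car V}\<rparr>"

text \<open>\<open>flip2\<close>, \<open>flip12\<close> and \<open>cycle3\<close> are \<open>\<tau>\<close>, \<open>\<tau> \<otimes> id\<close> and \<open>\<xi>\<close>; \<open>tmap2 V S T\<close> is \<open>S \<otimes> T\<close>.\<close>

definition flip2 :: "('k, 'v) tensor2 \<Rightarrow> ('k, 'v) tensor2" where
  "flip2 t = (\<lambda>f g. t g f)"

definition flip12 :: "('k, 'v) tensor3 \<Rightarrow> ('k, 'v) tensor3" where
  "flip12 t = (\<lambda>f g h. t g f h)"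

definition cycle3 :: "('k, 'v) tensor3 \<Rightarrow> ('k, 'v) tensor3" where
  "cycle3 t = (\<lambda>f g h. t h f g)"

definition tmap2 ::
  "('k::field, 'v::ab_group_add, 'm) vsp_scheme \<Rightarrow> ('v \<Rightarrow> 'v) \<Rightarrow> ('v \<Rightarrow> 'v)
     \<Rightarrow> ('k, 'v) tensor2 \<Rightarrow> ('k, 'v) tensor2" where
  "tmap2 V S T t = ext2 V (\<lambda>f g. t (dual_map V S f) (dual_map V T g))"

definition tmap3 ::
  "('k::field, 'v::ab_group_add, 'm) vsp_scheme \<Rightarrow> ('v \<Rightarrow> 'v) \<Rightarrow> ('v \<Rightarrow> 'v) \<Rightarrow> ('v \<Rightarrow> 'v)
     \<Rightarrow> ('k, 'v) tensor3 \<Rightarrow> ('k, 'v) tensor3" where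
  "tmap3 V S T U t = ext3 V (\<lambda>f g h. t (dual_map V S f) (dual_map V T g) (dual_map V U h))"

text \<open>\<open>D \<otimes> id\<close> and \<open>id \<otimes> D\<close> for \<open>D : V \<rightarrow> V \<otimes> V\<close>.\<close>

definition cop_left ::
  "('k::field, 'v::ab_group_add, 'm) vsp_scheme \<Rightarrow> ('v \<Rightarrow> ('k, 'v) tensor2)
     \<Rightarrow> ('k, 'v) tensor2 \<Rightarrow> ('k, 'v) tensor3" where
  "cop_left V D t = ext3 V (\<lambda>f g h. t (restr V (\<lambda>x. D x f g)) h)"

definition cop_right ::
  "('k::field, 'v::ab_group_add, 'm) vsp_scheme \<Rightarrow> ('v \<Rightarrow> ('k, 'v) tensor2)
     \<Rightarrow> ('k, 'v) tensor2 \<Rightarrow> ('k, 'v) tensor3" where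
  "cop_right V D t = ext3 V (\<lambda>f g h. t f (restr V (\<lambda>x. D x g h)))"

text \<open>\<open>r\<^sub>1\<^sub>2 \<diamond> r\<^sub>1\<^sub>3\<close>, \<open>r\<^sub>1\<^sub>2 \<diamond> r\<^sub>2\<^sub>3\<close> and \<open>r\<^sub>1\<^sub>3 \<diamond> r\<^sub>2\<^sub>3\<close> for a bilinear operation \<open>\<diamond>\<close> on \<open>V\<close>.\<close>

definition r12_13 ::
  "('k::field, 'v::ab_group_add, 'm) vsp_scheme \<Rightarrow> ('v \<Rightarrow> 'v \<Rightarrow> 'v)
     \<Rightarrow> ('k, 'v) tensor2 \<Rightarrow> ('k, 'v) tensor3" where
  "r12_13 V b r = ext3 V (\<lambda>f g h. r (restr V (\<lambda>x. r (restr V (\<lambda>y. f (b x y))) h)) g)"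

definition r12_23 ::
  "('k::field, 'v::ab_group_add, 'm) vsp_scheme \<Rightarrow> ('v \<Rightarrow> 'v \<Rightarrow> 'v)
     \<Rightarrow> ('k, 'v) tensor2 \<Rightarrow> ('k, 'v) tensor3" where
  "r12_23 V b r = ext3 V (\<lambda>f g h. r f (restr V (\<lambda>x. r (restr V (\<lambda>y. g (b x y))) h)))"

definition r13_23 ::
  "('k::field, 'v::ab_group_add, 'm) vsp_scheme \<Rightarrow> ('v \<Rightarrow> 'v \<Rightarrow> 'v)
     \<Rightarrow> ('k, 'v) tensor2 \<Rightarrow> ('k, 'v) tensor3" where
  "r13_23 V b r = ext3 V (\<lambda>f g h. r f (restr V (\<lambda>x. r g (restr V (\<lambda>y. h (b x y))))))"

context fd_space
begin

lemma car_add: "x \<in> car V \<Longrightarrow> y \<in> car V \<Longrightarrow> x + y \<in> car V"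
  and car_scl: "x \<in> car V \<Longrightarrow> scl V c x \<in> car V"
proof -
  interpret vector_space "scl V" by (rule ambient)
  show "x \<in> car V \<Longrightarrow> y \<in> car V \<Longrightarrow> x + y \<in> car V"
    using subspace_car by (rule subspace_add)
  show "x \<in> car V \<Longrightarrow> scl V c x \<in> car V"
    using subspace_car by (rule subspace_scale)
qed

lemma restr_apply: "x \<in> car V \<Longrightarrow> restr V f x = f x"
  by (simp add: restr_def)

lemma restr_cong: "(\<And>x. x \<in> car V \<Longrightarrow> f x = g x) \<Longrightarrow> restr V f = restr V g"
  by (auto simp: restr_def fun_eq_iff)

lemma restr_in_dual: "lin_map V ground f \<Longrightarrow> restr V f \<in> car (dualsp V)"
  by (auto simp: dualsp_def lin_map_def restr_def ground_def car_add car_scl)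

lemma dual_lin:
  "f \<in> car (dualsp V) \<Longrightarrow> x \<in> car V \<Longrightarrow> y \<in> car V \<Longrightarrow> f (x + y) = f x + f y"
  "f \<in> car (dualsp V) \<Longrightarrow> x \<in> car V \<Longrightarrow> f (scl V c x) = c * f x"
  by (auto simp: dualsp_def lin_map_def ground_def)

lemma dual_map_in_dual:
  "lin_map V V T \<Longrightarrow> f \<in> car (dualsp V) \<Longrightarrow> dual_map V T f \<in> car (dualsp V)"
  unfolding dual_map_def
  by (rule restr_in_dual) (auto simp: lin_map_def ground_def dual_lin)

lemma flip2_pure2: "flip2 (pure2 V x y) = pure2 V y x"
  by (auto simp: flip2_def pure2_def ext2_def fun_eq_iff)

lemma flip12_pure3: "flip12 (pure3 V x y z) = pure3 V y x z"
  by (auto simp: flip12_def pure3_def ext3_def fun_eq_iff)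

lemma cycle3_pure3: "cycle3 (pure3 V x y z) = pure3 V y z x"
  by (auto simp: cycle3_def pure3_def ext3_def fun_eq_iff)

lemma tmap2_pure2:
  assumes "lin_map V V S" "lin_map V V T" "x \<in> car V" "y \<in> car V"
  shows "tmap2 V S T (pure2 V x y) = pure2 V (S x) (T y)"
  using assms
  by (auto simp: tmap2_def pure2_def ext2_def fun_eq_iff dual_map_in_dual)
     (auto simp: dual_map_def restr_def)

lemma tmap3_pure3:
  assumes "lin_map V V S" "lin_map V V T" "lin_map V V U" "x \<in> car V" "y \<in> car V" "z \<in> car V"
  shows "tmap3 V S T U (pure3 V x y z) = pure3 V (S x) (T y) (U z)"
  using assms
  by (auto simp: tmap3_def pure3_def ext3_def fun_eq_iff dual_map_in_dual)
     (auto simp: dual_map_def restr_def)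

lemma sum_pure2_apply:
  "(\<Sum>i\<in>I. pure2 V (a i) (b i)) f g =
     (if f \<in> car (dualsp V) \<and> g \<in> car (dualsp V) then \<Sum>i\<in>I. f (a i) * g (b i) else 0)"
  by (induction I rule: infinite_finite_induct) (auto simp: pure2_def ext2_def)

lemma restr_cop_in_dual:
  assumes "lin_map V (tensor2 V) D"
  shows "restr V (\<lambda>x. D x f g) \<in> car (dualsp V)"
  using assms by (intro restr_in_dual) (auto simp: lin_map_def tensor2_def ground_def scl2_def)

lemma cop_left_pure2:
  assumes "lin_map V (tensor2 V) D" "x \<in> car V" "y \<in> car V"
    and "D x = (\<Sum>i\<in>I. pure2 V (a i) (b i))"
  shows "cop_left V D (pure2 V x y) = (\<Sum>i\<in>I. pure3 V (a i) (b i) y)"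
proof (intro ext)
  fix f g h :: "'v \<Rightarrow> 'k"
  have s3: "(\<Sum>i\<in>I. pure3 V (a i) (b i) y) f g h = (\<Sum>i\<in>I. pure3 V (a i) (b i) y f g h)" for I
    by (induction I rule: infinite_finite_induct) auto
  show "cop_left V D (pure2 V x y) f g h = (\<Sum>i\<in>I. pure3 V (a i) (b i) y) f g h"
    using assms(2,3) restr_cop_in_dual[OF assms(1), of f g]
    unfolding s3
    by (auto simp: cop_left_def pure3_def ext3_def pure2_def[of V x y] ext2_def[of V "\<lambda>f g. f x * g y"])
       (auto simp: restr_def assms(4) sum_pure2_apply sum_distrib_right)
qed

lemma cop_right_pure2:
  assumes "lin_map V (tensor2 V) D" "x \<in> car V" "y \<in> car V"
    and "D y = (\<Sum>i\<in>I. pure2 V (a i) (b i))"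
  shows "cop_right V D (pure2 V x y) = (\<Sum>i\<in>I. pure3 V x (a i) (b i))"
proof (intro ext)
  fix f g h :: "'v \<Rightarrow> 'k"
  have s3: "(\<Sum>i\<in>I. pure3 V x (a i) (b i)) f g h = (\<Sum>i\<in>I. pure3 V x (a i) (b i) f g h)" for I
    by (induction I rule: infinite_finite_induct) auto
  show "cop_right V D (pure2 V x y) f g h = (\<Sum>i\<in>I. pure3 V x (a i) (b i)) f g h"
    using assms(2,3) restr_cop_in_dual[OF assms(1), of g h]
    unfolding s3
    by (auto simp: cop_right_def pure3_def ext3_def pure2_def[of V x y] ext2_def[of V "\<lambda>f g. f x * g y"])
       (auto simp: restr_def assms(4) sum_pure2_apply sum_distrib_left mult.assoc)
qed

lemma sum_pure3_apply:
  "(\<Sum>i\<in>I. \<Sum>j\<in>I. pure3 V (a i j) (b i j) (c i j)) f g h =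
     (if f \<in> car (dualsp V) \<and> g \<in> car (dualsp V) \<and> h \<in> car (dualsp V)
      then \<Sum>i\<in>I. \<Sum>j\<in>I. f (a i j) * g (b i j) * h (c i j) else 0)"
proof -
  have *: "(\<Sum>j\<in>J. pure3 V (a i j) (b i j) (c i j)) f g h =
      (\<Sum>j\<in>J. pure3 V (a i j) (b i j) (c i j) f g h)" for i J
    by (induction J rule: infinite_finite_induct) auto
  have "(\<Sum>i\<in>K. \<Sum>j\<in>J. pure3 V (a i j) (b i j) (c i j)) f g h =
      (\<Sum>i\<in>K. \<Sum>j\<in>J. pure3 V (a i j) (b i j) (c i j) f g h)" for K J
    by (induction K rule: infinite_finite_induct) (auto simp: *)
  then show ?thesis by (auto simp: pure3_def ext3_def)
qed

lemma restr_op_in_dual: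
  assumes "bilin_map V V d" "f \<in> car (dualsp V)" "x \<in> car V"
  shows "restr V (\<lambda>y. f (d x y)) \<in> car (dualsp V)"
  using assms by (intro restr_in_dual) (auto simp: bilin_map_def lin_map_def ground_def dual_lin)

lemma restr_op_sum_in_dual:
  assumes "bilin_map V V d" "f \<in> car (dualsp V)" "\<And>j. j \<in> J \<Longrightarrow> a j \<in> car V"
  shows "restr V (\<lambda>x. \<Sum>j\<in>J. f (d x (a j)) * c j) \<in> car (dualsp V)"
  using assms
  by (intro restr_in_dual)
     (auto simp: bilin_map_def lin_map_def ground_def dual_lin sum_distrib_left algebra_simps
       simp flip: sum.distrib)

lemma
  assumes r: "r = (\<Sum>i\<in>I. pure2 V (a i) (b i))" and d: "bilin_map V V d"
    and ab: "\<And>i. i \<in> I \<Longrightarrow> a i \<in> car V" "\<And>i. i \<in> I \<Longrightarrow> b i \<in> car V"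
  shows r12_13_sum: "r12_13 V d r = (\<Sum>i\<in>I. \<Sum>j\<in>I. pure3 V (d (a i) (a j)) (b i) (b j))"
    and r12_23_sum: "r12_23 V d r = (\<Sum>i\<in>I. \<Sum>j\<in>I. pure3 V (a i) (d (b i) (a j)) (b j))"
    and r13_23_sum: "r13_23 V d r = (\<Sum>i\<in>I. \<Sum>j\<in>I. pure3 V (a i) (a j) (d (b i) (b j)))"
proof -
  have left: "restr V (\<lambda>x. r (restr V (\<lambda>y. f (d x y))) h) =
      restr V (\<lambda>x. \<Sum>j\<in>I. f (d x (a j)) * h (b j))"
    if "f \<in> car (dualsp V)" "h \<in> car (dualsp V)" for f h
    using that ab
    by (intro restr_cong) (auto simp: r sum_pure2_apply restr_op_in_dual[OF d] restr_apply)
  have right: "restr V (\<lambda>x. r g (restr V (\<lambda>y. h (d x y)))) =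
      restr V (\<lambda>x. \<Sum>j\<in>I. h (d x (b j)) * g (a j))"
    if "g \<in> car (dualsp V)" "h \<in> car (dualsp V)" for g h
    using that ab
    by (intro restr_cong) (auto simp: r sum_pure2_apply restr_op_in_dual[OF d] restr_apply mult.commute)
  have in_dual: "restr V (\<lambda>x. \<Sum>j\<in>I. f (d x (a j)) * h (b j)) \<in> car (dualsp V)"
      "restr V (\<lambda>x. \<Sum>j\<in>I. f (d x (b j)) * h (a j)) \<in> car (dualsp V)"
    if "f \<in> car (dualsp V)" for f h
    using that ab
    by (auto intro: restr_op_sum_in_dual[OF d, where c = "\<lambda>j. h (b j)"]
        restr_op_sum_in_dual[OF d, where c = "\<lambda>j. h (a j)"])
  show "r12_13 V d r = (\<Sum>i\<in>I. \<Sum>j\<in>I. pure3 V (d (a i) (a j)) (b i) (b j))"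
    using ab
    by (intro ext) (auto simp: r12_13_def ext3_def sum_pure3_apply left,
      auto simp: r sum_pure2_apply in_dual restr_apply,
      auto simp: sum_distrib_left sum_distrib_right mult_ac intro!: sum.cong)
  show "r12_23 V d r = (\<Sum>i\<in>I. \<Sum>j\<in>I. pure3 V (a i) (d (b i) (a j)) (b j))"
    using ab
    by (intro ext) (auto simp: r12_23_def ext3_def sum_pure3_apply left,
      auto simp: r sum_pure2_apply in_dual restr_apply,
      auto simp: sum_distrib_left sum_distrib_right mult_ac intro!: sum.cong)
  show "r13_23 V d r = (\<Sum>i\<in>I. \<Sum>j\<in>I. pure3 V (a i) (a j) (d (b i) (b j)))"
    using ab
    by (intro ext) (auto simp: r13_23_def ext3_def sum_pure3_apply right,
      auto simp: r sum_pure2_apply in_dual restr_apply,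
      auto simp: sum_distrib_left sum_distrib_right mult_ac intro!: sum.cong)
qed

end


section \<open>Relative Poisson algebras and Jacobi algebras\<close>

record ('k, 'v) jalg = "('k, 'v) vsp" +
  mul :: "'v \<Rightarrow> 'v \<Rightarrow> 'v"
  brk :: "'v \<Rightarrow> 'v \<Rightarrow> 'v"

record ('k, 'v) rpa = "('k, 'v) jalg" +
  der :: "'v \<Rightarrow> 'v"

locale comm_lie = fd_space R
  for R :: "('k::field, 'v::ab_group_add, 'm) jalg_scheme" +
  assumes mul_bilin: "bilin_map R R (mul R)"
    and mul_comm: "x \<in> car R \<Longrightarrow> y \<in> car R \<Longrightarrow> mul R x y = mul R y x"
    and mul_assoc: "x \<in> car R \<Longrightarrow> y \<in> car R \<Longrightarrow> z \<in> car R \<Longrightarrow>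
          mul R (mul R x y) z = mul R x (mul R y z)"
    and brk_bilin: "bilin_map R R (brk R)"
    and brk_alt: "x \<in> car R \<Longrightarrow> brk R x x = 0"
    and jacobi: "x \<in> car R \<Longrightarrow> y \<in> car R \<Longrightarrow> z \<in> car R \<Longrightarrow>
          brk R x (brk R y z) + brk R y (brk R z x) + brk R z (brk R x y) = 0"

definition is_unit :: "('k, 'v, 'm) jalg_scheme \<Rightarrow> 'v \<Rightarrow> bool" where
  "is_unit R u \<longleftrightarrow> u \<in> car R \<and> (\<forall>x\<in>car R. mul R u x = x \<and> mul R x u = x)"

definition is_derivation ::
  "('k, 'v::ab_group_add, 'm) vsp_scheme \<Rightarrow> ('v \<Rightarrow> 'v \<Rightarrow> 'v) \<Rightarrow> ('v \<Rightarrow> 'v) \<Rightarrow> bool" where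
  "is_derivation V b P \<longleftrightarrow>
     lin_map V V P \<and> (\<forall>x\<in>car V. \<forall>y\<in>car V. P (b x y) = b (P x) y + b x (P y))"

locale relative_poisson_algebra = comm_lie R
  for R :: "('k::field, 'v::ab_group_add, 'm) rpa_scheme" +
  assumes der_mul: "is_derivation R (mul R) (der R)"
    and der_brk: "is_derivation R (brk R) (der R)"
    and leibniz: "x \<in> car R \<Longrightarrow> y \<in> car R \<Longrightarrow> z \<in> car R \<Longrightarrow>
          brk R z (mul R x y) =
            mul R (brk R z x) y + mul R x (brk R z y) + mul R (mul R x y) (der R z)"

definition unital :: "('k, 'v, 'm) jalg_scheme \<Rightarrow> bool" where
  "unital R \<longleftrightarrow> (\<exists>u. is_unit R u)"

locale jacobi_algebra = comm_lie J
  for J :: "('k::field, 'v::ab_group_add, 'm) jalg_scheme" and u :: 'v +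
  assumes unit: "is_unit J u"
    and leibniz: "x \<in> car J \<Longrightarrow> y \<in> car J \<Longrightarrow> z \<in> car J \<Longrightarrow>
          brk J z (mul J x y) =
            mul J (brk J z x) y + mul J x (brk J z y) + mul J (mul J x y) (brk J u z)"

locale frobenius_jacobi_algebra = jacobi_algebra J u
  for J :: "('k::field, 'v::ab_group_add, 'm) jalg_scheme" and u :: 'v +
  fixes B :: "'v \<Rightarrow> 'v \<Rightarrow> 'k"
  assumes form_bilin: "bilin_map J ground B"
    and form_sym: "x \<in> car J \<Longrightarrow> y \<in> car J \<Longrightarrow> B x y = B y x"
    and form_nondeg: "x \<in> car J \<Longrightarrow> (\<And>y. y \<in> car J \<Longrightarrow> B x y = 0) \<Longrightarrow> x = 0"
    and form_mul: "x \<in> car J \<Longrightarrow> y \<in> car J \<Longrightarrow> z \<in> car J \<Longrightarrow>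
          B (mul J x y) z = B x (mul J y z)"
    and form_brk: "x \<in> car J \<Longrightarrow> y \<in> car J \<Longrightarrow> z \<in> car J \<Longrightarrow>
          B (brk J x y) z = B x (brk J y z)"


section \<open>Relative pre-Poisson algebras\<close>

record ('k, 'v) rppa = "('k, 'v) vsp" +
  zin :: "'v \<Rightarrow> 'v \<Rightarrow> 'v"
  prl :: "'v \<Rightarrow> 'v \<Rightarrow> 'v"
  pder :: "'v \<Rightarrow> 'v"

locale relative_pre_poisson_algebra = fd_space A
  for A :: "('k::field, 'v::ab_group_add, 'm) rppa_scheme" +
  assumes zin_bilin: "bilin_map A A (zin A)"
    and zinbiel: "x \<in> car A \<Longrightarrow> y \<in> car A \<Longrightarrow> z \<in> car A \<Longrightarrow>
          zin A x (zin A y z) = zin A (zin A y x) z + zin A (zin A x y) z"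
    and prl_bilin: "bilin_map A A (prl A)"
    and pre_lie: "x \<in> car A \<Longrightarrow> y \<in> car A \<Longrightarrow> z \<in> car A \<Longrightarrow>
          prl A (prl A x y) z - prl A x (prl A y z) = prl A (prl A y x) z - prl A y (prl A x z)"
    and der_zin: "is_derivation A (zin A) (pder A)"
    and der_prl: "is_derivation A (prl A) (pder A)"
    and compat1: "x \<in> car A \<Longrightarrow> y \<in> car A \<Longrightarrow> z \<in> car A \<Longrightarrow>
          prl A (zin A x y + zin A y x) z - zin A x (prl A y z) - zin A y (prl A x z)
            + zin A (zin A x y + zin A y x) (pder A z) = 0"
    and compat2: "x \<in> car A \<Longrightarrow> y \<in> car A \<Longrightarrow> z \<in> car A \<Longrightarrow>
          prl A y (zin A x z) - zin A x (prl A y z) + zin A (prl A x y - prl A y x) z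
            - zin A (zin A x (pder A y) + zin A (pder A y) x) z = 0"

definition subadjacent :: "('k, 'v::ab_group_add, 'm) rppa_scheme \<Rightarrow> ('k, 'v) rpa" where
  "subadjacent A = \<lparr>scl = scl A, car = car A,
     mul = (\<lambda>x y. zin A x y + zin A y x),
     brk = (\<lambda>x y. prl A x y - prl A y x),
     der = pder A\<rparr>"

text \<open>In the extension by a unit, \<open>(x, a)\<close> stands for \<open>x + a e\<close>.\<close>

definition unit_ext ::
  "('k::field, 'v::ab_group_add, 'm) rpa_scheme \<Rightarrow> ('k, 'v \<times> 'k) rpa" where
  "unit_ext R = \<lparr>scl = (\<lambda>c (x, a). (scl R c x, c * a)), car = car R \<times> UNIV,
     mul = (\<lambda>(x, a) (y, b). (mul R x y + scl R a y + scl R b x, a * b)),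
     brk = (\<lambda>(x, a) (y, b). (brk R x y + scl R a (der R y) - scl R b (der R x), 0)),
     der = (\<lambda>(x, a). (der R x, 0))\<rparr>"

definition zin_ext :: "('k, 'v::ab_group_add, 'm) rppa_scheme \<Rightarrow> 'v \<times> 'k \<Rightarrow> 'v \<Rightarrow> 'v" where
  "zin_ext A = (\<lambda>(x, a) v. zin A x v + scl A a v)"

definition prl_ext :: "('k, 'v::ab_group_add, 'm) rppa_scheme \<Rightarrow> 'v \<times> 'k \<Rightarrow> 'v \<Rightarrow> 'v" where
  "prl_ext A = (\<lambda>(x, a) v. prl A x v + scl A a (pder A v))"

text \<open>The semi-direct product of \<open>R\<close> and \<open>V\<close> along \<open>\<mu>\<close>, \<open>\<nu>\<close>, with derivation \<open>der R + \<alpha>\<close>.\<close>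

definition semidirect ::
  "('k::field, 'v::ab_group_add, 'm) rpa_scheme \<Rightarrow> ('k, 'w::ab_group_add, 'n) vsp_scheme
     \<Rightarrow> ('v \<Rightarrow> 'w \<Rightarrow> 'w) \<Rightarrow> ('v \<Rightarrow> 'w \<Rightarrow> 'w) \<Rightarrow> ('w \<Rightarrow> 'w) \<Rightarrow> ('k, 'v \<times> 'w) rpa" where
  "semidirect R V \<mu> \<nu> \<alpha> = \<lparr>scl = (\<lambda>c (x, u). (scl R c x, scl V c u)), car = car R \<times> car V,
     mul = (\<lambda>(x, u) (y, v). (mul R x y, \<mu> x v + \<mu> y u)),
     brk = (\<lambda>(x, u) (y, v). (brk R x y, \<nu> x v - \<nu> y u)),
     der = map_prod (der R) \<alpha>\<rparr>"


section \<open>The relative Poisson Yang-Baxter equation\<close>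

definition antisymmetric :: "('k::ab_group_add, 'v) tensor2 \<Rightarrow> bool" where
  "antisymmetric r \<longleftrightarrow> r + flip2 r = 0"

definition rpybe_solution ::
  "('k::field, 'v::ab_group_add, 'm) rpa_scheme \<Rightarrow> ('v \<Rightarrow> 'v) \<Rightarrow> ('k, 'v) tensor2 \<Rightarrow> bool" where
  "rpybe_solution R Q r \<longleftrightarrow> r \<in> car (tensor2 R) \<and> lin_map R R Q \<and>
     r12_13 R (mul R) r - r12_23 R (mul R) r + r13_23 R (mul R) r = 0 \<and>
     r12_13 R (brk R) r + r12_23 R (brk R) r + r13_23 R (brk R) r = 0 \<and>
     tmap2 R (der R) id r - tmap2 R id Q r = 0 \<and>
     tmap2 R Q id r - tmap2 R id (der R) r = 0"


section \<open>Relative Poisson bialgebras\<close>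

definition dually_represents ::
  "('k, 'v::ab_group_add, 'm) rpa_scheme \<Rightarrow> ('v \<Rightarrow> 'v) \<Rightarrow> bool" where
  "dually_represents R Q \<longleftrightarrow> lin_map R R Q \<and>
     (\<forall>x\<in>car R. \<forall>y\<in>car R. mul R x (Q y) - mul R (der R x) y - Q (mul R x y) = 0) \<and>
     (\<forall>x\<in>car R. \<forall>y\<in>car R. brk R x (Q y) - brk R (der R x) y - Q (brk R x y) = 0) \<and>
     (\<forall>x\<in>car R. \<forall>y\<in>car R. \<forall>z\<in>car R.
        brk R x (mul R y z) + brk R y (mul R z x) + brk R z (mul R x y)
          + Q (mul R (mul R x y) z) = 0)"

locale relative_poisson_coalgebra = fd_space V
  for V :: "('k::field, 'v::ab_group_add, 'm) vsp_scheme" +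
  fixes \<Delta> \<delta> :: "'v \<Rightarrow> ('k, 'v) tensor2" and Q :: "'v \<Rightarrow> 'v"
  assumes \<Delta>_lin: "lin_map V (tensor2 V) \<Delta>"
    and \<delta>_lin: "lin_map V (tensor2 V) \<delta>"
    and Q_lin: "lin_map V V Q"
    and \<Delta>_cocomm: "x \<in> car V \<Longrightarrow> flip2 (\<Delta> x) = \<Delta> x"
    and \<Delta>_coassoc: "x \<in> car V \<Longrightarrow> cop_right V \<Delta> (\<Delta> x) = cop_left V \<Delta> (\<Delta> x)"
    and \<delta>_coanti: "x \<in> car V \<Longrightarrow> flip2 (\<delta> x) = - \<delta> x"
    and \<delta>_cojacobi: "x \<in> car V \<Longrightarrow>
          cop_right V \<delta> (\<delta> x) + cycle3 (cop_right V \<delta> (\<delta> x))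
            + cycle3 (cycle3 (cop_right V \<delta> (\<delta> x))) = 0"
    and Q_\<Delta>: "x \<in> car V \<Longrightarrow> \<Delta> (Q x) = tmap2 V Q id (\<Delta> x) + tmap2 V id Q (\<Delta> x)"
    and Q_\<delta>: "x \<in> car V \<Longrightarrow> \<delta> (Q x) = tmap2 V Q id (\<delta> x) + tmap2 V id Q (\<delta> x)"
    and coleibniz: "x \<in> car V \<Longrightarrow>
          cop_right V \<Delta> (\<delta> x) - cop_left V \<delta> (\<Delta> x) - flip12 (cop_right V \<delta> (\<Delta> x))
            - tmap3 V Q id id (cop_left V \<Delta> (\<Delta> x)) = 0"

locale relative_poisson_bialgebra =
  relative_poisson_algebra R + relative_poisson_coalgebra R \<Delta> \<delta> Q
  for R :: "('k::field, 'v::ab_group_add, 'm) rpa_scheme"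
    and \<Delta> \<delta> :: "'v \<Rightarrow> ('k, 'v) tensor2" and Q :: "'v \<Rightarrow> 'v" +
  assumes dually_rep: "dually_represents R Q"
    and P_\<Delta>: "x \<in> car R \<Longrightarrow> \<Delta> (der R x) = tmap2 R (der R) id (\<Delta> x) - tmap2 R id Q (\<Delta> x)"
    and P_\<delta>: "x \<in> car R \<Longrightarrow> \<delta> (der R x) = tmap2 R (der R) id (\<delta> x) - tmap2 R id Q (\<delta> x)"
    and PQ_\<Delta>: "x \<in> car R \<Longrightarrow> cop_left R \<Delta> (\<Delta> (der R x + Q x)) = 0"
    and \<Delta>_mul: "x \<in> car R \<Longrightarrow> y \<in> car R \<Longrightarrow>
          \<Delta> (mul R x y) = tmap2 R (mul R x) id (\<Delta> y) + tmap2 R id (mul R y) (\<Delta> x)"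
    and \<delta>_brk: "x \<in> car R \<Longrightarrow> y \<in> car R \<Longrightarrow>
          \<delta> (brk R x y) =
            (tmap2 R (brk R x) id (\<delta> y) + tmap2 R id (brk R x) (\<delta> y))
            - (tmap2 R (brk R y) id (\<delta> x) + tmap2 R id (brk R y) (\<delta> x))"
    and \<delta>_mul: "x \<in> car R \<Longrightarrow> y \<in> car R \<Longrightarrow>
          \<delta> (mul R x y) - tmap2 R id (brk R y) (\<Delta> x) - tmap2 R (mul R x) id (\<delta> y)
            - tmap2 R id (brk R x) (\<Delta> y) - tmap2 R (mul R y) id (\<delta> x)
            - tmap2 R id Q (\<Delta> (mul R x y)) = 0"
    and \<Delta>_brk: "x \<in> car R \<Longrightarrow> y \<in> car R \<Longrightarrow>
          \<Delta> (brk R x y) - tmap2 R (mul R y) id (\<delta> x) - tmap2 R id (brk R x) (\<Delta> y)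
            + tmap2 R id (mul R y) (\<delta> x) - tmap2 R (brk R x) id (\<Delta> y)
            + \<Delta> (mul R (der R x) y) = 0"

text \<open>
  The relative Poisson algebra on \<open>R\<^sup>*\<close>; the value \<open>\<Delta> x a b\<close> is the pairing of \<open>\<Delta>(x)\<close> with
  \<open>a \<otimes> b\<close>.
\<close>

definition dual_rpa ::
  "('k::field, 'v::ab_group_add, 'm) vsp_scheme \<Rightarrow> ('v \<Rightarrow> ('k, 'v) tensor2)
     \<Rightarrow> ('v \<Rightarrow> ('k, 'v) tensor2) \<Rightarrow> ('v \<Rightarrow> 'v) \<Rightarrow> ('k, 'v \<Rightarrow> 'k) rpa" where
  "dual_rpa R \<Delta> \<delta> Q = \<lparr>scl = scl (dualsp R), car = car (dualsp R),
     mul = (\<lambda>a b. restr R (\<lambda>x. \<Delta> x a b)),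
     brk = (\<lambda>a b. restr R (\<lambda>x. \<delta> x a b)),
     der = dual_map R Q\<rparr>"

text \<open>For \<open>\<phi> : R\<^sup>* \<rightarrow> End(R\<^sup>*)\<close>, the map \<open>\<phi>\<^sup>*\<close> as a map into \<open>End(R)\<close>, via \<open>R\<^sup>*\<^sup>* = R\<close>.\<close>

definition predual_rep ::
  "('k::field, 'v::ab_group_add, 'm) vsp_scheme \<Rightarrow> (('v \<Rightarrow> 'k) \<Rightarrow> ('v \<Rightarrow> 'k) \<Rightarrow> 'v \<Rightarrow> 'k)
     \<Rightarrow> ('v \<Rightarrow> 'k) \<Rightarrow> 'v \<Rightarrow> 'v" where
  "predual_rep R \<phi> a y = unev R (dual_rep (dualsp R) \<phi> a (ev R y))"

definition bowtie ::
  "('k::field, 'v::ab_group_add, 'm) rpa_scheme \<Rightarrow> ('v \<Rightarrow> ('k, 'v) tensor2)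
     \<Rightarrow> ('v \<Rightarrow> ('k, 'v) tensor2) \<Rightarrow> ('v \<Rightarrow> 'v) \<Rightarrow> ('k, 'v \<times> ('v \<Rightarrow> 'k)) rpa" where
  "bowtie R \<Delta> \<delta> Q = (let S = dual_rpa R \<Delta> \<delta> Q in
     \<lparr>scl = (\<lambda>c (x, a). (scl R c x, scl S c a)), car = car R \<times> car S,
      mul = (\<lambda>(x, a) (y, b).
        (mul R x y - predual_rep R (mul S) a y - predual_rep R (mul S) b x,
         mul S a b - dual_rep R (mul R) x b - dual_rep R (mul R) y a)),
      brk = (\<lambda>(x, a) (y, b).
        (brk R x y + predual_rep R (brk S) a y - predual_rep R (brk S) b x,
         brk S a b + dual_rep R (brk R) x b - dual_rep R (brk R) y a)),
      der = map_prod (der R) (der S)\<rparr>)"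

definition pairing_form :: "'v \<times> ('v \<Rightarrow> 'k::plus) \<Rightarrow> 'v \<times> ('v \<Rightarrow> 'k) \<Rightarrow> 'k" where
  "pairing_form = (\<lambda>(x, a) (y, b). b x + a y)"

end

theory Submission
  imports Defs
begin

text \<open>
  The whole statement becomes transparent once the tensor is replaced by an operator. An
  antisymmetric \<open>r\<close> on a relative Poisson algebra \<open>(D, P)\<close> is the same thing as a linear map
  \<open>R : D\<^sup>* \<rightarrow> D\<close> with \<open>r(f, g) = g (R f)\<close> and \<open>g (R f) = - f (R g)\<close>. Evaluated on functionals, the
  \<open>(-P)\<close>-Yang-Baxter equation says that two cyclic sums such as
  \<open>f (R g \<cdot> R h) + g (R h \<cdot> R f) + h (R f \<cdot> R g)\<close> vanish and that \<open>R (f \<circ> P) = - P (R f)\<close>; this is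
  the locale \<open>rpybe_operator\<close>.

  Take \<open>Q = -P\<close> and form the semidirect product \<open>D \<ltimes> D\<^sup>*\<close> along the dual of the adjoint
  representation. The cyclic identities say that the graph \<open>{(R f, f)}\<close> is closed under both
  operations of \<open>D \<ltimes> D\<^sup>*\<close>, and the operations it induces on \<open>D\<^sup>*\<close> are exactly the transposes of
  \<open>\<Delta>\<close> and \<open>\<delta>\<close>. So \<open>D\<^sup>*\<close> is a relative Poisson algebra (\<open>star_rpa\<close>), and reading its axioms
  backwards gives the coalgebra axioms (\<open>relative_poisson_coalgebraI\<close>). The compatibility
  conditions of a bialgebra are then identities between values on pairs \<open>(f, g)\<close>, in which moving
  \<open>R\<close> from one functional to the other cancels the terms that do not match by the axioms of \<open>D\<close>
  (\<open>bialgebra\<close>).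

  The double \<open>D \<bowtie> D\<^sup>*\<close> looks complicated, but the shear \<open>(x, a) \<mapsto> (x + R a, a)\<close> is an isomorphism
  from it onto \<open>D \<ltimes> D\<^sup>*\<close>, and because \<open>R\<close> is skew the shear preserves the pairing form. Hence the
  relative Poisson axioms of the double (\<open>bow_rpa\<close>) and the invariance of its form are
  inherited from the semidirect product, where they are easy. A unital relative Poisson algebra
  is a Jacobi algebra because its derivation must be \<open>[1, -]\<close> (\<open>der_unit\<close>), which gives
  \<open>bow_frobenius\<close>.

  For the algebra in question, the axioms of a relative pre-Poisson algebra say that left
  multiplications represent the subadjacent algebra on \<open>A\<close>. The representation extends to the
  algebra with a unit adjoined and dualizes, which gives the semidirect product \<open>D\<close> on
  \<open>(A \<oplus> K e) \<oplus> A\<^sup>*\<close>. A functional \<open>f\<close> on it restricts to \<open>\<alpha> f \<in> A\<^sup>*\<close> and to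
  \<open>\<beta> f \<in> A\<^sup>*\<^sup>* = A\<close>; the operator of the given tensor is \<open>R f = - \<beta> f + \<alpha> f\<close>, and its cyclic
  identities hold because the operations of the subadjacent algebra are the symmetrization of
  \<open>\<star>\<close> and the commutator of \<open>\<circ>\<close> (\<open>R_operator\<close>).
\<close>

section \<open>Finite-dimensional spaces and their duals\<close>

context fd_space
begin

lemma vector_space_rules:
  "scl V c (x + y) = scl V c x + scl V c y"
  "scl V (c + d) x = scl V c x + scl V d x"
  "scl V c (scl V d x) = scl V (c * d) x"
  "scl V c (x - y) = scl V c x - scl V c y"
  "scl V (c - d) x = scl V c x - scl V d x"
  "scl V c (- x) = - scl V c x"
  "scl V (- c) x = - scl V c x"
  "scl V 1 x = x" "scl V 0 x = 0" "scl V c 0 = 0"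
proof -
  interpret vector_space "scl V" by (rule ambient)
  show "scl V c (x + y) = scl V c x + scl V c y"
    "scl V (c + d) x = scl V c x + scl V d x"
    "scl V c (scl V d x) = scl V (c * d) x"
    "scl V c (x - y) = scl V c x - scl V c y"
    "scl V (c - d) x = scl V c x - scl V d x"
    "scl V c (- x) = - scl V c x"
    "scl V (- c) x = - scl V c x"
    "scl V 1 x = x" "scl V 0 x = 0" "scl V c 0 = 0"
    by (simp_all add: scale_right_distrib scale_left_distrib scale_right_diff_distrib
        scale_left_diff_distrib)
qed

lemma car_zero: "0 \<in> car V"
  and car_neg: "x \<in> car V \<Longrightarrow> - x \<in> car V"
  and car_diff: "x \<in> car V \<Longrightarrow> y \<in> car V \<Longrightarrow> x - y \<in> car V"
  and car_sum: "(\<And>i. i \<in> I \<Longrightarrow> a i \<in> car V) \<Longrightarrow> sum a I \<in> car V"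
proof -
  interpret vector_space "scl V" by (rule ambient)
  show "0 \<in> car V" "x \<in> car V \<Longrightarrow> - x \<in> car V"
    "x \<in> car V \<Longrightarrow> y \<in> car V \<Longrightarrow> x - y \<in> car V"
    "(\<And>i. i \<in> I \<Longrightarrow> a i \<in> car V) \<Longrightarrow> sum a I \<in> car V"
    using subspace_car by (auto intro: subspace_0 subspace_neg subspace_diff subspace_sum)
qed

lemmas car_rules = car_zero car_neg car_diff car_add car_scl

lemma lin_map_rules:
  fixes W :: "('k, 'w::ab_group_add, 'n) vsp_scheme"
  assumes T: "lin_map V W T"
  shows "x \<in> car V \<Longrightarrow> T x \<in> car W"
    and "x \<in> car V \<Longrightarrow> y \<in> car V \<Longrightarrow> T (x + y) = T x + T y"
    and "x \<in> car V \<Longrightarrow> T (scl V c x) = scl W c (T x)"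
    and "T 0 = 0"
    and "x \<in> car V \<Longrightarrow> T (- x) = - T x"
    and "x \<in> car V \<Longrightarrow> y \<in> car V \<Longrightarrow> T (x - y) = T x - T y"
proof -
  show in_W: "T x \<in> car W" if "x \<in> car V" for x
    using T that by (simp add: lin_map_def)
  show add: "T (x + y) = T x + T y" if "x \<in> car V" "y \<in> car V" for x y
    using T that by (simp add: lin_map_def)
  show "x \<in> car V \<Longrightarrow> T (scl V c x) = scl W c (T x)"
    using T by (simp add: lin_map_def)
  show zero: "T 0 = 0"
    using add[of 0 0] car_zero by simp
  show neg: "T (- x) = - T x" if "x \<in> car V" for x
  proof -
    have "T x + T (- x) = 0"
      using add[of x "- x"] that zero by (simp add: car_neg)
    then show ?thesis by (metis minus_unique)
  qed
  show "T (x - y) = T x - T y" if "x \<in> car V" "y \<in> car V"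
    using add[of x "- y"] neg[of y] that by (simp add: car_neg)
qed

lemma lin_map_sum:
  fixes W :: "('k, 'w::ab_group_add, 'n) vsp_scheme"
  assumes T: "lin_map V W T" and a: "\<And>i. i \<in> I \<Longrightarrow> a i \<in> car V"
  shows "T (sum a I) = (\<Sum>i\<in>I. T (a i))"
  using a
  by (induction I rule: infinite_finite_induct) (auto simp: lin_map_rules[OF T] car_sum)

lemma dual_lin_map: "f \<in> car (dualsp V) \<Longrightarrow> lin_map V ground f"
  by (simp add: dualsp_def)

lemma dual_rules:
  assumes "f \<in> car (dualsp V)"
  shows "x \<in> car V \<Longrightarrow> y \<in> car V \<Longrightarrow> f (x + y) = f x + f y"
    and "x \<in> car V \<Longrightarrow> f (scl V c x) = c * f x"
    and "f 0 = 0"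
    and "x \<in> car V \<Longrightarrow> f (- x) = - f x"
    and "x \<in> car V \<Longrightarrow> y \<in> car V \<Longrightarrow> f (x - y) = f x - f y"
    and "x \<notin> car V \<Longrightarrow> f x = 0"
  using lin_map_rules[OF dual_lin_map[OF assms]] assms
  by (simp_all add: ground_def dualsp_def)

lemma dual_sum:
  assumes "f \<in> car (dualsp V)" "\<And>i. i \<in> I \<Longrightarrow> a i \<in> car V"
  shows "f (sum a I) = (\<Sum>i\<in>I. f (a i))"
  using lin_map_sum[OF dual_lin_map] assms by blast

lemma dual_eqI:
  assumes "f \<in> car (dualsp V)" "g \<in> car (dualsp V)" "\<And>x. x \<in> car V \<Longrightarrow> f x = g x"
  shows "f = g"
  using assms by (force simp: dualsp_def)

text \<open>
  All finiteness is used through this statement: a finite spanning family with coordinate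
  functionals. Reflexivity, separation of points and finite-dimensionality of the dual follow from
  the expansion alone.
\<close>
lemma dual_coordinates:
  obtains B c where "finite B" "B \<subseteq> car V" "\<And>b. b \<in> B \<Longrightarrow> c b \<in> car (dualsp V)"
    "\<And>x. x \<in> car V \<Longrightarrow> x = (\<Sum>b\<in>B. scl V (c b x) b)"
proof -
  interpret vector_space "scl V" by (rule ambient)
  obtain C where C: "finite C" "span C = car V" using fin_dim by blast
  obtain B where B: "B \<subseteq> C" "independent B" "C \<subseteq> span B"
    using maximal_independent_subset[of C] by blast
  have fin: "finite B" using B(1) C(1) finite_subset by blast
  have span: "span B = car V"
    using span_mono[OF B(1)] span_mono[OF B(3)] C(2) by (simp add: span_span)
  have "restr V (\<lambda>x. representation B x b) \<in> car (dualsp V)" for b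
    by (rule restr_in_dual)
      (auto simp: lin_map_def ground_def representation_add representation_scale B(2) span)
  moreover have "x = (\<Sum>b\<in>B. scl V (restr V (\<lambda>x. representation B x b) x) b)" if "x \<in> car V" for x
    using sum_representation_eq[OF B(2), of x B] fin that by (simp add: restr_apply span)
  ultimately show thesis
    using that[of B "\<lambda>b. restr V (\<lambda>x. representation B x b)"] fin span span_superset by blast
qed

lemma dual_rep_apply: "dual_rep V \<phi> x u v = (if v \<in> car V then - u (\<phi> x v) else 0)"
  by (simp add: dual_rep_def restr_def)

lemma dual_map_apply: "dual_map V T u v = (if v \<in> car V then u (T v) else 0)"
  by (simp add: dual_map_def restr_def)

lemma dual_separates:
  assumes "x \<in> car V" "y \<in> car V" "\<And>f. f \<in> car (dualsp V) \<Longrightarrow> f x = f y"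
  shows "x = y"
proof -
  obtain B c where B: "finite B" "B \<subseteq> car V" "\<And>b. b \<in> B \<Longrightarrow> c b \<in> car (dualsp V)"
    "\<And>x. x \<in> car V \<Longrightarrow> x = (\<Sum>b\<in>B. scl V (c b x) b)"
    by (rule dual_coordinates) blast
  have "x = (\<Sum>b\<in>B. scl V (c b x) b)" using assms by (intro B)
  also have "\<dots> = (\<Sum>b\<in>B. scl V (c b y) b)" by (intro sum.cong) (simp_all add: assms(3) B(3))
  also have "\<dots> = y" using B(4)[OF assms(2)] by simp
  finally show ?thesis .
qed

lemma dual_vector_space: "vector_space (scl (dualsp V))"
  by unfold_locales (auto simp: dualsp_def fun_eq_iff algebra_simps)

lemma dual_expansion:
  assumes B: "B \<subseteq> car V" "\<And>b. b \<in> B \<Longrightarrow> c b \<in> car (dualsp V)"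
    "\<And>x. x \<in> car V \<Longrightarrow> x = (\<Sum>b\<in>B. scl V (c b x) b)"
    and f: "f \<in> car (dualsp V)"
  shows "f = (\<Sum>b\<in>B. scl (dualsp V) (f b) (c b))"
proof
  fix x
  have app: "(\<Sum>b\<in>B. scl (dualsp V) (f b) (c b)) x = (\<Sum>b\<in>B. f b * c b x)"
    by (induction B rule: infinite_finite_induct) (auto simp: dualsp_def)
  show "f x = (\<Sum>b\<in>B. scl (dualsp V) (f b) (c b)) x"
  proof (cases "x \<in> car V")
    case True
    have "f x = f (\<Sum>b\<in>B. scl V (c b x) b)" using B(3)[OF True] by simp
    also have "\<dots> = (\<Sum>b\<in>B. f b * c b x)"
      using B(1) by (subst dual_sum[OF f])
        (auto simp: car_scl dual_rules[OF f] mult.commute intro!: sum.cong)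
    finally show ?thesis by (simp add: app)
  next
    case False
    have "(\<Sum>b\<in>B. f b * c b x) = 0"
      using B(2) False by (intro sum.neutral) (auto simp: dual_rules)
    then show ?thesis using False by (simp add: app dual_rules[OF f])
  qed
qed

text \<open>Duality of the two families already forces the coefficients, whatever expansion is chosen.\<close>
lemma dual_basis_expansion:
  assumes inj: "inj_on e I" and fin: "finite I" and span: "module.span (scl V) (e ` I) = car V"
    and e': "\<And>i. i \<in> I \<Longrightarrow> e' i \<in> car (dualsp V)"
    and dual: "\<And>i j. i \<in> I \<Longrightarrow> j \<in> I \<Longrightarrow> e' i (e j) = (if i = j then 1 else 0)"
    and x: "x \<in> car V"
  shows "x = (\<Sum>i\<in>I. scl V (e' i x) (e i))"
proof -
  interpret vector_space "scl V" by (rule ambient)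
  have e: "e i \<in> car V" if "i \<in> I" for i
    using span span_superset[of "e ` I"] that by blast
  obtain u where "x = (\<Sum>v\<in>e ` I. scl V (u v) v)"
    using x span span_finite[of "e ` I"] fin by auto
  then have u: "x = (\<Sum>i\<in>I. scl V (u (e i)) (e i))"
    by (simp add: sum.reindex[OF inj])
  have "e' j x = u (e j)" if j: "j \<in> I" for j
  proof -
    have "e' j x = (\<Sum>i\<in>I. u (e i) * e' j (e i))"
      unfolding u by (subst dual_sum[OF e'[OF j]])
        (auto simp: car_scl e dual_rules[OF e'[OF j]] intro!: sum.cong)
    also have "\<dots> = (\<Sum>i\<in>I. if j = i then u (e i) else 0)"
      using j by (intro sum.cong) (auto simp: dual)
    also have "\<dots> = u (e j)" using j fin by simp
    finally show ?thesis .
  qed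
  then have "(\<Sum>i\<in>I. scl V (e' i x) (e i)) = (\<Sum>i\<in>I. scl V (u (e i)) (e i))"
    by (intro sum.cong) simp_all
  then show ?thesis using u by simp
qed

lemma dual_fd_space: "fd_space (dualsp V)"
proof (rule fd_space.intro)
  interpret dual: vector_space "scl (dualsp V)" by (rule dual_vector_space)
  show "vector_space (scl (dualsp V))" by (rule dual_vector_space)
  show sub: "module.subspace (scl (dualsp V)) (car (dualsp V))"
    by (rule dual.subspaceI) (auto simp: dualsp_def lin_map_def ground_def algebra_simps)
  obtain B c where B: "finite B" "B \<subseteq> car V" "\<And>b. b \<in> B \<Longrightarrow> c b \<in> car (dualsp V)"
    "\<And>x. x \<in> car V \<Longrightarrow> x = (\<Sum>b\<in>B. scl V (c b x) b)"
    by (rule dual_coordinates) blast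
  have "dual.span (c ` B) = car (dualsp V)"
  proof
    show "dual.span (c ` B) \<subseteq> car (dualsp V)"
      using B(3) by (intro dual.span_minimal sub) auto
    show "car (dualsp V) \<subseteq> dual.span (c ` B)"
    proof
      fix f assume "f \<in> car (dualsp V)"
      then have "f = (\<Sum>b\<in>B. scl (dualsp V) (f b) (c b))"
        using B by (intro dual_expansion)
      also have "\<dots> \<in> dual.span (c ` B)"
        by (intro dual.span_sum dual.span_scale dual.span_base) auto
      finally show "f \<in> dual.span (c ` B)" .
    qed
  qed
  then show "\<exists>C. finite C \<and> module.span (scl (dualsp V)) C = car (dualsp V)"
    using B(1) by blast
qed

lemma dual_map_lin:
  assumes "lin_map V V T"
  shows "lin_map (dualsp V) (dualsp V) (dual_map V T)"
  unfolding lin_map_def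
proof (intro conjI ballI allI)
  fix f g c assume "f \<in> car (dualsp V)" "g \<in> car (dualsp V)"
  show "dual_map V T f \<in> car (dualsp V)" by (rule dual_map_in_dual) fact+
  show "dual_map V T (f + g) = dual_map V T f + dual_map V T g"
    "dual_map V T (scl (dualsp V) c f) = scl (dualsp V) c (dual_map V T f)"
    by (auto simp: fun_eq_iff dual_map_apply) (auto simp: dualsp_def dual_map_apply)
qed

text \<open>Functionals separate points, so the description in \<open>unev\<close> is satisfied by \<open>x\<close> alone.\<close>
lemma unev_ev:
  assumes "x \<in> car V" shows "unev V (ev V x) = x"
proof -
  have "y = x" if "y \<in> car V" "ev V y = ev V x" for y
  proof (rule dual_separates)
    fix f assume "f \<in> car (dualsp V)"
    then show "f y = f x" using fun_cong[OF that(2), of f] by (simp add: ev_def restr_def)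
  qed (use assms that in auto)
  then show ?thesis unfolding unev_def using assms by blast
qed

text \<open>
  This makes \<open>D \<otimes> D\<close> accessible without spans: the form of an operator \<open>T : V\<^sup>* \<rightarrow> V\<close> is
  \<open>\<Sum> b \<otimes> T b\<^sup>*\<close> for any basis, by expanding the first argument.
\<close>
lemma operator_in_tensor2:
  assumes T: "lin_map (dualsp V) V T"
  shows "ext2 V (\<lambda>f g. g (T f)) \<in> car (tensor2 V)"
proof -
  interpret dual: fd_space "dualsp V" by (rule dual_fd_space)
  interpret t: vector_space "scl2 :: 'k \<Rightarrow> ('k, 'v) tensor2 \<Rightarrow> _"
    by unfold_locales (auto simp: scl2_def fun_eq_iff algebra_simps)
  obtain B c where fin: "finite B"
    and B: "B \<subseteq> car V" "\<And>b. b \<in> B \<Longrightarrow> c b \<in> car (dualsp V)"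
    "\<And>x. x \<in> car V \<Longrightarrow> x = (\<Sum>b\<in>B. scl V (c b x) b)"
    by (rule dual_coordinates) blast
  have "ext2 V (\<lambda>f g. g (T f)) = (\<Sum>b\<in>B. pure2 V b (T (c b)))"
  proof (intro ext)
    fix f g :: "'v \<Rightarrow> 'k"
    show "ext2 V (\<lambda>f g. g (T f)) f g = (\<Sum>b\<in>B. pure2 V b (T (c b))) f g"
    proof (cases "f \<in> car (dualsp V) \<and> g \<in> car (dualsp V)")
      case True
      have Tc: "T (c b) \<in> car V" if "b \<in> B" for b
        using B(2) that dual.lin_map_rules(1)[OF T] by blast
      have "T f = T (\<Sum>b\<in>B. scl (dualsp V) (f b) (c b))"
        using dual_expansion[OF B] True by simp
      also have "\<dots> = (\<Sum>b\<in>B. scl V (f b) (T (c b)))"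
        using B(2) by (subst dual.lin_map_sum[OF T])
          (auto simp: dual.car_scl dual.lin_map_rules[OF T] intro!: sum.cong)
      finally have "g (T f) = (\<Sum>b\<in>B. f b * g (T (c b)))"
        using True Tc by (simp add: dual_sum car_scl dual_rules)
      then show ?thesis using True by (simp add: ext2_def sum_pure2_apply)
    qed (auto simp: ext2_def sum_pure2_apply)
  qed
  also have "\<dots> \<in> t.span {pure2 V x y | x y. x \<in> car V \<and> y \<in> car V}"
    using B(1,2) dual.lin_map_rules(1)[OF T]
    by (intro t.span_sum t.span_base) blast
  finally show ?thesis by (simp add: tensor2_def)
qed

end

lemma ground_fd_space: "fd_space (ground :: ('k::field, 'k) vsp)"
proof (rule fd_space.intro)
  interpret vector_space "(*) :: 'k \<Rightarrow> 'k \<Rightarrow> 'k"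
    by unfold_locales (auto simp: algebra_simps)
  show "vector_space (scl (ground :: ('k, 'k) vsp))"
    by (simp add: ground_def vector_space_axioms)
  show "module.subspace (scl ground) (car (ground :: ('k, 'k) vsp))"
    by (simp add: ground_def)
  have "x \<in> span {1}" for x :: 'k
    using span_scale[OF span_base, of 1 "{1}" x] by simp
  then show "\<exists>B. finite B \<and> module.span (scl ground) B = car (ground :: ('k, 'k) vsp)"
    by (intro exI[of _ "{1}"]) (auto simp: ground_def)
qed

lemma product_fd_space:
  fixes V :: "('k::field, 'v::ab_group_add, 'm) vsp_scheme"
    and W :: "('k, 'w::ab_group_add, 'n) vsp_scheme"
    and X :: "('k, 'v \<times> 'w, 'l) vsp_scheme"
  assumes "fd_space V" "fd_space W"
    and scl: "scl X = (\<lambda>c (x, u). (scl V c x, scl W c u))" and car: "car X = car V \<times> car W"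
  shows "fd_space X"
proof (rule fd_space.intro)
  interpret V: fd_space V by fact
  interpret W: fd_space W by fact
  show vs: "vector_space (scl X)"
    by unfold_locales (auto simp: scl V.vector_space_rules W.vector_space_rules)
  interpret x: vector_space "scl X" by (rule vs)
  show sub: "module.subspace (scl X) (car X)"
    by (rule x.subspaceI)
      (auto simp: scl car zero_prod_def V.car_rules W.car_rules)
  obtain B b where B: "finite B" "B \<subseteq> car V"
    "\<And>x. x \<in> car V \<Longrightarrow> x = (\<Sum>i\<in>B. scl V (b i x) i)"
    by (rule V.dual_coordinates) blast
  obtain C c where C: "finite C" "C \<subseteq> car W"
    "\<And>u. u \<in> car W \<Longrightarrow> u = (\<Sum>i\<in>C. scl W (c i u) i)"
    by (rule W.dual_coordinates) blast
  let ?S = "(\<lambda>x. (x, 0)) ` B \<union> (\<lambda>u. (0, u)) ` C"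
  have "x.span ?S = car X"
  proof
    show "x.span ?S \<subseteq> car X"
      using B(2) C(2) by (intro x.span_minimal sub) (auto simp: car V.car_zero W.car_zero)
    show "car X \<subseteq> x.span ?S"
    proof
      fix z assume "z \<in> car X"
      then obtain x u where z: "z = (x, u)" and xu: "x \<in> car V" "u \<in> car W"
        by (auto simp: car)
      have "(\<Sum>i\<in>B. scl X (b i x) (i, 0)) = (\<Sum>i\<in>B. scl V (b i x) i, 0)"
        by (auto simp: prod_eq_iff fst_sum snd_sum scl W.vector_space_rules)
      moreover have "(\<Sum>i\<in>C. scl X (c i u) (0, i)) = (0, \<Sum>i\<in>C. scl W (c i u) i)"
        by (auto simp: prod_eq_iff fst_sum snd_sum scl V.vector_space_rules)
      ultimately have "z = (\<Sum>i\<in>B. scl X (b i x) (i, 0)) + (\<Sum>i\<in>C. scl X (c i u) (0, i))"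
        using B(3)[OF xu(1)] C(3)[OF xu(2)] by (simp add: z)
      also have "\<dots> \<in> x.span ?S"
        by (intro x.span_add x.span_sum x.span_scale x.span_base) auto
      finally show "z \<in> x.span ?S" .
    qed
  qed
  then show "\<exists>B. finite B \<and> module.span (scl X) B = car X"
    using B(1) C(1) by (intro exI[of _ ?S]) simp
qed

text \<open>Actions of an algebra on another space need bilinearity with two different domains.\<close>
definition bilin_maps ::
  "('k, 'u::plus, 'l) vsp_scheme \<Rightarrow> ('k, 'v::plus, 'm) vsp_scheme \<Rightarrow> ('k, 'w::plus, 'n) vsp_scheme
     \<Rightarrow> ('u \<Rightarrow> 'v \<Rightarrow> 'w) \<Rightarrow> bool" where
  "bilin_maps U V W b \<longleftrightarrow>
     (\<forall>x\<in>car U. lin_map V W (\<lambda>y. b x y)) \<and> (\<forall>y\<in>car V. lin_map U W (\<lambda>x. b x y))"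

lemma bilin_map_iff: "bilin_map V W b \<longleftrightarrow> bilin_maps V V W b"
  by (simp add: bilin_map_def bilin_maps_def)

lemma bilin_maps_rules:
  assumes U: "fd_space U" and V: "fd_space V"
    and b: "bilin_maps U V (W :: ('k::field, 'w::ab_group_add, 'n) vsp_scheme) b"
  shows "x \<in> car U \<Longrightarrow> y \<in> car V \<Longrightarrow> b x y \<in> car W"
    and "x \<in> car U \<Longrightarrow> x' \<in> car U \<Longrightarrow> y \<in> car V \<Longrightarrow> b (x + x') y = b x y + b x' y"
    and "x \<in> car U \<Longrightarrow> y \<in> car V \<Longrightarrow> y' \<in> car V \<Longrightarrow> b x (y + y') = b x y + b x y'"
    and "x \<in> car U \<Longrightarrow> y \<in> car V \<Longrightarrow> b (scl U c x) y = scl W c (b x y)"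
    and "x \<in> car U \<Longrightarrow> y \<in> car V \<Longrightarrow> b x (scl V c y) = scl W c (b x y)"
    and "y \<in> car V \<Longrightarrow> b 0 y = 0"
    and "x \<in> car U \<Longrightarrow> b x 0 = 0"
    and "x \<in> car U \<Longrightarrow> y \<in> car V \<Longrightarrow> b (- x) y = - b x y"
    and "x \<in> car U \<Longrightarrow> y \<in> car V \<Longrightarrow> b x (- y) = - b x y"
    and "x \<in> car U \<Longrightarrow> x' \<in> car U \<Longrightarrow> y \<in> car V \<Longrightarrow> b (x - x') y = b x y - b x' y"
    and "x \<in> car U \<Longrightarrow> y \<in> car V \<Longrightarrow> y' \<in> car V \<Longrightarrow> b x (y - y') = b x y - b x y'"
proof -
  have r: "lin_map V W (b x)" if "x \<in> car U" for x
    using b that by (simp add: bilin_maps_def)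
  have l: "lin_map U W (\<lambda>x. b x y)" if "y \<in> car V" for y
    using b that by (simp add: bilin_maps_def)
  note R = fd_space.lin_map_rules[OF V r] and L = fd_space.lin_map_rules[OF U l]
  show "x \<in> car U \<Longrightarrow> y \<in> car V \<Longrightarrow> b x y \<in> car W"
    "x \<in> car U \<Longrightarrow> x' \<in> car U \<Longrightarrow> y \<in> car V \<Longrightarrow> b (x + x') y = b x y + b x' y"
    "x \<in> car U \<Longrightarrow> y \<in> car V \<Longrightarrow> y' \<in> car V \<Longrightarrow> b x (y + y') = b x y + b x y'"
    "x \<in> car U \<Longrightarrow> y \<in> car V \<Longrightarrow> b (scl U c x) y = scl W c (b x y)"
    "x \<in> car U \<Longrightarrow> y \<in> car V \<Longrightarrow> b x (scl V c y) = scl W c (b x y)"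
    "y \<in> car V \<Longrightarrow> b 0 y = 0"
    "x \<in> car U \<Longrightarrow> b x 0 = 0"
    "x \<in> car U \<Longrightarrow> y \<in> car V \<Longrightarrow> b (- x) y = - b x y"
    "x \<in> car U \<Longrightarrow> y \<in> car V \<Longrightarrow> b x (- y) = - b x y"
    "x \<in> car U \<Longrightarrow> x' \<in> car U \<Longrightarrow> y \<in> car V \<Longrightarrow> b (x - x') y = b x y - b x' y"
    "x \<in> car U \<Longrightarrow> y \<in> car V \<Longrightarrow> y' \<in> car V \<Longrightarrow> b x (y - y') = b x y - b x y'"
    by (blast intro: R L)+
qed

section \<open>Representations and semidirect products\<close>

context comm_lie
begin

lemmas mul_rules = bilin_maps_rules[OF fd_space_axioms fd_space_axioms mul_bilin[unfolded bilin_map_iff]]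
lemmas brk_rules = bilin_maps_rules[OF fd_space_axioms fd_space_axioms brk_bilin[unfolded bilin_map_iff]]

lemma brk_antisym:
  assumes "x \<in> car R" "y \<in> car R" shows "brk R x y = - brk R y x"
proof -
  have "0 = brk R (x + y) (x + y)"
    using assms by (simp only: brk_alt car_add)
  also have "\<dots> = brk R x y + brk R y x"
    using assms by (simp only: brk_rules car_add) (simp add: brk_alt)
  finally have "brk R x y + brk R y x = 0" by simp
  then show ?thesis by (simp add: eq_neg_iff_add_eq_0)
qed

end

context relative_poisson_algebra
begin

lemma der_lin: "lin_map R R (der R)"
  using der_mul by (simp add: is_derivation_def)

lemmas der_rules = lin_map_rules[OF der_lin]

lemma der_mul_apply: "x \<in> car R \<Longrightarrow> y \<in> car R \<Longrightarrow> der R (mul R x y) = mul R (der R x) y + mul R x (der R y)"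
  and der_brk_apply: "x \<in> car R \<Longrightarrow> y \<in> car R \<Longrightarrow> der R (brk R x y) = brk R (der R x) y + brk R x (der R y)"
  using der_mul der_brk by (simp_all add: is_derivation_def)

end

lemma comm_lieI:
  assumes "fd_space (R :: ('k::field, 'v::ab_group_add, 'm) jalg_scheme)"
    and "bilin_map R R (mul R)"
    and "\<And>x y. x \<in> car R \<Longrightarrow> y \<in> car R \<Longrightarrow> mul R x y = mul R y x"
    and "\<And>x y z. x \<in> car R \<Longrightarrow> y \<in> car R \<Longrightarrow> z \<in> car R \<Longrightarrow>
          mul R (mul R x y) z = mul R x (mul R y z)"
    and "bilin_map R R (brk R)"
    and "\<And>x. x \<in> car R \<Longrightarrow> brk R x x = 0"
    and "\<And>x y z. x \<in> car R \<Longrightarrow> y \<in> car R \<Longrightarrow> z \<in> car R \<Longrightarrow>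
          brk R x (brk R y z) + brk R y (brk R z x) + brk R z (brk R x y) = 0"
  shows "comm_lie R"
  using assms by (intro comm_lie.intro comm_lie_axioms.intro)

text \<open>
  The axioms are those of a relative Poisson algebra with one factor placed in the module:
  \<open>\<rho>_\<sigma>\<close> is the Leibniz rule with the module element inside the product, \<open>\<rho>_mul\<close> the one with it
  outside.
\<close>
locale rpa_representation = B: relative_poisson_algebra B + V: fd_space V
  for B :: "('k::field, 'b::ab_group_add, 'm) rpa_scheme"
    and V :: "('k, 'v::ab_group_add, 'n) vsp_scheme" +
  fixes \<sigma> \<rho> :: "'b \<Rightarrow> 'v \<Rightarrow> 'v" and p :: "'v \<Rightarrow> 'v"
  assumes \<sigma>_bilin: "bilin_maps B V V \<sigma>"
    and \<rho>_bilin: "bilin_maps B V V \<rho>"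
    and p_lin: "lin_map V V p"
    and \<sigma>_mul: "x \<in> car B \<Longrightarrow> y \<in> car B \<Longrightarrow> v \<in> car V \<Longrightarrow> \<sigma> (mul B x y) v = \<sigma> x (\<sigma> y v)"
    and \<rho>_brk: "x \<in> car B \<Longrightarrow> y \<in> car B \<Longrightarrow> v \<in> car V \<Longrightarrow>
          \<rho> (brk B x y) v = \<rho> x (\<rho> y v) - \<rho> y (\<rho> x v)"
    and p_\<sigma>: "x \<in> car B \<Longrightarrow> v \<in> car V \<Longrightarrow> p (\<sigma> x v) = \<sigma> (der B x) v + \<sigma> x (p v)"
    and p_\<rho>: "x \<in> car B \<Longrightarrow> v \<in> car V \<Longrightarrow> p (\<rho> x v) = \<rho> (der B x) v + \<rho> x (p v)"
    and \<rho>_\<sigma>: "x \<in> car B \<Longrightarrow> y \<in> car B \<Longrightarrow> v \<in> car V \<Longrightarrow>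
          \<rho> y (\<sigma> x v) = \<sigma> x (\<rho> y v) + \<sigma> (brk B y x) v + \<sigma> (mul B x (der B y)) v"
    and \<rho>_mul: "x \<in> car B \<Longrightarrow> y \<in> car B \<Longrightarrow> v \<in> car V \<Longrightarrow>
          \<rho> (mul B x y) v = \<sigma> x (\<rho> y v) + \<sigma> y (\<rho> x v) - \<sigma> (mul B x y) (p v)"
begin

lemmas \<sigma>_rules = bilin_maps_rules[OF B.fd_space_axioms V.fd_space_axioms \<sigma>_bilin]
lemmas \<rho>_rules = bilin_maps_rules[OF B.fd_space_axioms V.fd_space_axioms \<rho>_bilin]
lemmas p_rules = V.lin_map_rules[OF p_lin]

lemma \<sigma>_comm:
  "x \<in> car B \<Longrightarrow> y \<in> car B \<Longrightarrow> v \<in> car V \<Longrightarrow> \<sigma> y (\<sigma> x v) = \<sigma> x (\<sigma> y v)"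
  using \<sigma>_mul[of x y v] \<sigma>_mul[of y x v] B.mul_comm[of x y] by simp

text \<open>
  The Leibniz rule \<open>\<rho>_mul\<close> with the operators composed in the opposite order. Transposition
  reverses compositions, so this is what \<open>\<rho>_mul\<close> of the dual representation amounts to.
\<close>
lemma \<rho>_mul_dual:
  assumes "x \<in> car B" "y \<in> car B" "v \<in> car V"
  shows "\<rho> (mul B x y) v = \<rho> x (\<sigma> y v) + \<rho> y (\<sigma> x v) - p (\<sigma> (mul B x y) v)"
proof -
  have "\<sigma> (brk B y x) v = - \<sigma> (brk B x y) v"
    using B.brk_antisym[of y x] assms by (simp add: \<sigma>_rules B.brk_rules)
  moreover have "\<sigma> (mul B y (der B x)) v = \<sigma> (mul B (der B x) y) v"
    using B.mul_comm[of y "der B x"] assms by (simp add: B.der_rules)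
  ultimately show ?thesis
    using assms
    by (simp add: \<rho>_mul \<rho>_\<sigma> p_\<sigma> B.der_mul_apply \<sigma>_rules B.mul_rules B.der_rules)
qed

lemma semidirect_rpa: "relative_poisson_algebra (semidirect B V \<sigma> \<rho> p)"
  (is "relative_poisson_algebra ?S")
proof (intro relative_poisson_algebra.intro relative_poisson_algebra_axioms.intro comm_lieI)
  note defs = semidirect_def bilin_map_def lin_map_def is_derivation_def
  note rules = \<sigma>_rules \<rho>_rules p_rules B.mul_rules B.brk_rules B.der_rules B.car_rules V.car_rules
    B.vector_space_rules V.vector_space_rules
  show "fd_space ?S"
    by (rule product_fd_space[OF B.fd_space_axioms V.fd_space_axioms])
      (simp_all add: semidirect_def)
  show "bilin_map ?S ?S (mul ?S)"
    by (auto simp: defs rules)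
  show "bilin_map ?S ?S (brk ?S)"
    by (auto simp: defs rules)
  show "mul ?S x y = mul ?S y x" if "x \<in> car ?S" "y \<in> car ?S" for x y
    using that by (auto simp: defs B.mul_comm)
  show "mul ?S (mul ?S x y) z = mul ?S x (mul ?S y z)"
    if "x \<in> car ?S" "y \<in> car ?S" "z \<in> car ?S" for x y z
    using that by (auto simp: defs rules B.mul_assoc \<sigma>_mul \<sigma>_comm)
  show "brk ?S x x = 0" if "x \<in> car ?S" for x
    using that by (auto simp: defs B.brk_alt zero_prod_def)
  show "brk ?S x (brk ?S y z) + brk ?S y (brk ?S z x) + brk ?S z (brk ?S x y) = 0"
    if "x \<in> car ?S" "y \<in> car ?S" "z \<in> car ?S" for x y z
    using that by (auto simp: defs rules \<rho>_brk B.jacobi zero_prod_def)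
  show "is_derivation ?S (mul ?S) (der ?S)"
    by (auto simp: defs rules B.der_mul_apply p_\<sigma>)
  show "is_derivation ?S (brk ?S) (der ?S)"
    by (auto simp: defs rules B.der_brk_apply p_\<rho>)
  show "brk ?S z (mul ?S x y) =
      mul ?S (brk ?S z x) y + mul ?S x (brk ?S z y) + mul ?S (mul ?S x y) (der ?S z)"
    if "x \<in> car ?S" "y \<in> car ?S" "z \<in> car ?S" for x y z
    using that by (auto simp: defs rules B.leibniz \<rho>_\<sigma> \<rho>_mul \<sigma>_mul \<sigma>_comm)
qed

text \<open>
  With the sign conventions \<open>-\<sigma>\<^sup>*\<close>, \<open>\<rho>\<^sup>*\<close> and \<open>-p\<^sup>*\<close>, each axiom evaluated at a vector is the same
  axiom of the original representation with the compositions reversed; only \<open>\<rho>_mul\<close> needs more than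
  commutativity, namely \<open>\<rho>_mul_dual\<close>.
\<close>
lemma dual_representation:
  "rpa_representation B (dualsp V) (\<lambda>x u. - dual_rep V \<sigma> x u) (dual_rep V \<rho>) (\<lambda>u. - dual_map V p u)"
  (is "rpa_representation B ?W ?\<sigma> ?\<rho> ?p")
proof -
  interpret W: fd_space ?W by (rule V.dual_fd_space)
  note W_apply = V.dual_rep_apply V.dual_map_apply
  note rules = \<sigma>_rules \<rho>_rules p_rules B.mul_rules B.brk_rules B.der_rules B.car_rules V.car_rules
    B.vector_space_rules V.vector_space_rules
  have dual_iff: "f \<in> car ?W \<longleftrightarrow> (\<forall>x\<in>car V. \<forall>y\<in>car V. f (x + y) = f x + f y) \<and>
      (\<forall>c. \<forall>x\<in>car V. f (scl V c x) = c * f x) \<and> (\<forall>x. x \<notin> car V \<longrightarrow> f x = 0)" for f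
    by (auto simp: dualsp_def lin_map_def ground_def)
  have scl_apply: "scl ?W c u v = c * u v" for c u v by (simp add: dualsp_def)
  have in_W: "?\<sigma> x u \<in> car ?W" "?\<rho> x u \<in> car ?W" if "x \<in> car B" "u \<in> car ?W" for x u
    using that unfolding dual_iff
    by (auto simp: W_apply rules V.dual_rules[OF that(2)])
  have p_in_W: "?p u \<in> car ?W" if "u \<in> car ?W" for u
    using that unfolding dual_iff
    by (auto simp: W_apply rules V.dual_rules[OF that])
  show ?thesis
  proof (intro rpa_representation.intro rpa_representation_axioms.intro)
    show "relative_poisson_algebra B" "fd_space ?W"
      by (fact B.relative_poisson_algebra_axioms W.fd_space_axioms)+
    show "bilin_maps B ?W ?W ?\<sigma>" "bilin_maps B ?W ?W ?\<rho>"
      using in_W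
      by (auto simp: bilin_maps_def lin_map_def fun_eq_iff W_apply scl_apply rules V.dual_rules
          algebra_simps)
    show "lin_map ?W ?W ?p"
      using p_in_W
      by (auto simp: lin_map_def fun_eq_iff W_apply scl_apply rules V.dual_rules algebra_simps)
    fix x y u assume xy: "x \<in> car B" "y \<in> car B" and u: "u \<in> car ?W"
    note rules = rules W_apply fun_eq_iff xy V.dual_rules[OF u]
    show "?\<sigma> (mul B x y) u = ?\<sigma> x (?\<sigma> y u)"
      by (auto simp: rules \<sigma>_mul \<sigma>_comm)
    show "?\<rho> (brk B x y) u = ?\<rho> x (?\<rho> y u) - ?\<rho> y (?\<rho> x u)"
      by (auto simp: rules \<rho>_brk)
    show "?p (?\<sigma> x u) = ?\<sigma> (der B x) u + ?\<sigma> x (?p u)"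
      by (auto simp: rules p_\<sigma>)
    show "?p (?\<rho> x u) = ?\<rho> (der B x) u + ?\<rho> x (?p u)"
      by (auto simp: rules p_\<rho>)
    show "?\<rho> y (?\<sigma> x u) = ?\<sigma> x (?\<rho> y u) + ?\<sigma> (brk B y x) u + ?\<sigma> (mul B x (der B y)) u"
      by (auto simp: rules \<rho>_\<sigma>)
    show "?\<rho> (mul B x y) u = ?\<sigma> x (?\<rho> y u) + ?\<sigma> y (?\<rho> x u) - ?\<sigma> (mul B x y) (?p u)"
      by (auto simp: rules \<rho>_mul_dual)
  qed
qed

end

lemma (in relative_poisson_algebra) adjoint_representation:
  "rpa_representation R R (mul R) (brk R) (der R)"
proof (intro rpa_representation.intro rpa_representation_axioms.intro)
  fix x y v assume xyv: "x \<in> car R" "y \<in> car R" "v \<in> car R"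
  show "brk R (brk R x y) v = brk R x (brk R y v) - brk R y (brk R x v)"
  proof -
    have "brk R v (brk R x y) = - brk R (brk R x y) v"
      using xyv by (intro brk_antisym) (simp_all add: brk_rules)
    moreover have "brk R y (brk R v x) = - brk R y (brk R x v)"
      using xyv brk_antisym[of v x] by (simp add: brk_rules)
    ultimately show ?thesis
      using jacobi[OF xyv] by (simp add: algebra_simps)
  qed
  show "brk R y (mul R x v) = mul R x (brk R y v) + mul R (brk R y x) v + mul R (mul R x (der R y)) v"
  proof -
    have "mul R (mul R x v) (der R y) = mul R (mul R x (der R y)) v"
      using xyv mul_comm[of v "der R y"] by (simp add: mul_assoc der_rules)
    then show ?thesis using xyv by (simp add: leibniz)
  qed
  show "brk R (mul R x y) v = mul R x (brk R y v) + mul R y (brk R x v) - mul R (mul R x y) (der R v)"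
    using xyv brk_antisym[of "mul R x y" v] brk_antisym[of v x] brk_antisym[of v y]
      mul_comm[of "brk R x v" y]
    by (simp add: leibniz mul_rules brk_rules)
qed (use relative_poisson_algebra_axioms fd_space_axioms mul_bilin brk_bilin der_lin in
    \<open>auto simp: bilin_map_iff mul_assoc der_mul_apply der_brk_apply\<close>)

text \<open>The bracket \<open>[e, x] = P x\<close> turns the derivation property of \<open>P\<close> into the Jacobi identity.\<close>
lemma (in relative_poisson_algebra) unit_ext_rpa: "relative_poisson_algebra (unit_ext R)"
  (is "relative_poisson_algebra ?E")
proof (intro relative_poisson_algebra.intro relative_poisson_algebra_axioms.intro comm_lieI)
  note defs = unit_ext_def bilin_map_def lin_map_def is_derivation_def
  note rules = mul_rules brk_rules der_rules car_rules vector_space_rules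
  show "fd_space ?E"
    by (rule product_fd_space[OF fd_space_axioms ground_fd_space])
      (simp_all add: unit_ext_def ground_def)
  show "bilin_map ?E ?E (mul ?E)"
    by (auto simp: defs rules algebra_simps)
  show "bilin_map ?E ?E (brk ?E)"
    by (auto simp: defs rules algebra_simps)
  show "mul ?E x y = mul ?E y x" if "x \<in> car ?E" "y \<in> car ?E" for x y
    using that by (auto simp: defs mul_comm)
  show "mul ?E (mul ?E x y) z = mul ?E x (mul ?E y z)"
    if "x \<in> car ?E" "y \<in> car ?E" "z \<in> car ?E" for x y z
    using that by (auto simp: defs rules mul_assoc mult_ac add_ac)
  show "brk ?E x x = 0" if "x \<in> car ?E" for x
    using that by (auto simp: defs brk_alt zero_prod_def)
  show "brk ?E x (brk ?E y z) + brk ?E y (brk ?E z x) + brk ?E z (brk ?E x y) = 0"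
    if xyz: "x \<in> car ?E" "y \<in> car ?E" "z \<in> car ?E" for x y z
  proof -
    obtain x0 a y0 b z0 c where e: "x = (x0, a)" "y = (y0, b)" "z = (z0, c)"
      by (cases x, cases y, cases z) auto
    have c: "x0 \<in> car R" "y0 \<in> car R" "z0 \<in> car R" using xyz by (auto simp: e unit_ext_def)
    have "brk R x0 (brk R y0 z0) = - brk R y0 (brk R z0 x0) - brk R z0 (brk R x0 y0)"
      using jacobi[OF c] by (simp add: algebra_simps eq_neg_iff_add_eq_0)
    moreover have "brk R (der R x0) y0 = - brk R y0 (der R x0)" "brk R (der R y0) z0 = - brk R z0 (der R y0)"
      "brk R (der R z0) x0 = - brk R x0 (der R z0)"
      using c by (auto intro!: brk_antisym simp: der_rules)
    ultimately show ?thesis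
      using c by (simp add: e defs rules der_brk_apply zero_prod_def mult_ac)
  qed
  show "is_derivation ?E (mul ?E) (der ?E)"
    by (auto simp: defs rules der_mul_apply)
  show "is_derivation ?E (brk ?E) (der ?E)"
    by (auto simp: defs rules der_brk_apply)
  show "brk ?E z (mul ?E x y) =
      mul ?E (brk ?E z x) y + mul ?E x (brk ?E z y) + mul ?E (mul ?E x y) (der ?E z)"
    if "x \<in> car ?E" "y \<in> car ?E" "z \<in> car ?E" for x y z
    using that by (auto simp: defs rules leibniz der_mul_apply mult_ac mul_comm[of "der R _"])
qed

text \<open>
  The adjoined unit acts as the identity through \<open>\<sigma>\<close> and, since \<open>[e, -]\<close> is the derivation, as \<open>p\<close>
  through \<open>\<rho>\<close>.
\<close>
lemma (in rpa_representation) unit_ext_representation: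
  "rpa_representation (unit_ext B) V (\<lambda>(x, a) v. \<sigma> x v + scl V a v)
     (\<lambda>(x, a) v. \<rho> x v + scl V a (p v)) p"
proof (intro rpa_representation.intro rpa_representation_axioms.intro)
  note rules = \<sigma>_rules \<rho>_rules p_rules B.mul_rules B.brk_rules B.der_rules B.car_rules V.car_rules
    B.vector_space_rules V.vector_space_rules
  let ?E = "unit_ext B" and ?\<sigma> = "\<lambda>(x, a) v. \<sigma> x v + scl V a v"
    and ?\<rho> = "\<lambda>(x, a) v. \<rho> x v + scl V a (p v)"
  note defs = unit_ext_def
  show "relative_poisson_algebra ?E" "fd_space V" "lin_map V V p"
    by (fact B.unit_ext_rpa V.fd_space_axioms p_lin)+
  show "bilin_maps ?E V V ?\<sigma>" "bilin_maps ?E V V ?\<rho>"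
    by (auto simp: bilin_maps_def lin_map_def defs rules mult_ac)
  fix x y v assume xyv: "x \<in> car ?E" "y \<in> car ?E" "v \<in> car V"
  show "?\<sigma> (mul ?E x y) v = ?\<sigma> x (?\<sigma> y v)"
    using xyv by (auto simp: defs rules \<sigma>_mul)
  show "?\<rho> (brk ?E x y) v = ?\<rho> x (?\<rho> y v) - ?\<rho> y (?\<rho> x v)"
    using xyv by (auto simp: defs rules \<rho>_brk p_\<rho> mult_ac)
  show "p (?\<sigma> x v) = ?\<sigma> (der ?E x) v + ?\<sigma> x (p v)"
    using xyv by (auto simp: defs rules p_\<sigma>)
  show "p (?\<rho> x v) = ?\<rho> (der ?E x) v + ?\<rho> x (p v)"
    using xyv by (auto simp: defs rules p_\<rho>)
  show "?\<rho> y (?\<sigma> x v) = ?\<sigma> x (?\<rho> y v) + ?\<sigma> (brk ?E y x) v + ?\<sigma> (mul ?E x (der ?E y)) v"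
    using xyv by (auto simp: defs rules p_\<sigma> \<rho>_\<sigma> mult_ac)
  show "?\<rho> (mul ?E x y) v = ?\<sigma> x (?\<rho> y v) + ?\<sigma> y (?\<rho> x v) - ?\<sigma> (mul ?E x y) (p v)"
    using xyv by (auto simp: defs rules \<rho>_mul mult_ac)
qed

context relative_pre_poisson_algebra
begin

lemmas zin_rules = bilin_maps_rules[OF fd_space_axioms fd_space_axioms zin_bilin[unfolded bilin_map_iff]]
lemmas prl_rules = bilin_maps_rules[OF fd_space_axioms fd_space_axioms prl_bilin[unfolded bilin_map_iff]]

lemma pder_lin: "lin_map A A (pder A)"
  using der_zin by (simp add: is_derivation_def)

lemmas pder_rules = lin_map_rules[OF pder_lin]

lemma subadjacent_rpa: "relative_poisson_algebra (subadjacent A)"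
  (is "relative_poisson_algebra ?R")
proof (intro relative_poisson_algebra.intro relative_poisson_algebra_axioms.intro comm_lieI)
  note defs = subadjacent_def bilin_map_def lin_map_def is_derivation_def
  note rules = zin_rules prl_rules pder_rules car_rules vector_space_rules
  show "fd_space ?R"
    using ambient subspace_car fin_dim by (intro fd_space.intro) (simp_all add: subadjacent_def)
  show "bilin_map ?R ?R (mul ?R)"
    by (auto simp: defs rules)
  show "bilin_map ?R ?R (brk ?R)"
    by (auto simp: defs rules)
  show "is_derivation ?R (mul ?R) (der ?R)" "is_derivation ?R (brk ?R) (der ?R)"
    using der_zin der_prl by (auto simp: defs rules)
  fix x y z assume c: "x \<in> car ?R" "y \<in> car ?R" "z \<in> car ?R"
  then have xyz: "x \<in> car A" "y \<in> car A" "z \<in> car A" by (auto simp: subadjacent_def)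
  show "mul ?R x y = mul ?R y x" "brk ?R x x = 0"
    by (simp_all add: subadjacent_def add.commute)
  show "mul ?R (mul ?R x y) z = mul ?R x (mul ?R y z)"
    using xyz zinbiel by (simp add: subadjacent_def rules)
  show "brk ?R x (brk ?R y z) + brk ?R y (brk ?R z x) + brk ?R z (brk ?R x y) = 0"
  proof -
    have "prl A (prl A x y) z = prl A x (prl A y z) + (prl A (prl A y x) z - prl A y (prl A x z))"
      if "x \<in> car A" "y \<in> car A" "z \<in> car A" for x y z
      using pre_lie[OF that] by (simp add: diff_eq_eq add.commute)
    from this[of x y z] this[of y z x] this[of z x y] show ?thesis
      using xyz by (simp add: subadjacent_def rules)
  qed
  show "brk ?R z (mul ?R x y) =
      mul ?R (brk ?R z x) y + mul ?R x (brk ?R z y) + mul ?R (mul ?R x y) (der ?R z)"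
  proof -
    have "prl A (zin A x y) z = zin A x (prl A y z) + zin A y (prl A x z)
        - zin A (zin A x y) (pder A z) - zin A (zin A y x) (pder A z) - prl A (zin A y x) z"
      using compat1[OF xyz] xyz by (simp add: rules algebra_simps)
    moreover have "prl A z (zin A x y) = zin A x (prl A z y) - zin A (prl A x z) y + zin A (prl A z x) y
        + zin A (zin A x (pder A z)) y + zin A (zin A (pder A z) x) y"
      if "x \<in> car A" "y \<in> car A" for x y
      using compat2[of x z y] that xyz by (simp add: rules algebra_simps)
    note this[OF xyz(1,2)] this[OF xyz(2,1)]
    ultimately show ?thesis
      using xyz zinbiel by (simp add: subadjacent_def rules)
  qed
qed

text \<open>
  The axioms of a relative pre-Poisson algebra are the representation axioms for left
  multiplications, written out.
\<close>
lemma left_multiplication_representation: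
  "rpa_representation (subadjacent A) A (zin A) (prl A) (pder A)"
proof (intro rpa_representation.intro rpa_representation_axioms.intro)
  note rules = zin_rules prl_rules pder_rules car_rules vector_space_rules
  let ?R = "subadjacent A"
  show "relative_poisson_algebra ?R" "fd_space A" "lin_map A A (pder A)"
    by (fact subadjacent_rpa fd_space_axioms pder_lin)+
  show "bilin_maps ?R A A (zin A)" "bilin_maps ?R A A (prl A)"
    by (auto simp: bilin_maps_def lin_map_def subadjacent_def rules)
  fix x y v assume "x \<in> car ?R" "y \<in> car ?R" and v: "v \<in> car A"
  then have xy: "x \<in> car A" "y \<in> car A" by (auto simp: subadjacent_def)
  show "zin A (mul ?R x y) v = zin A x (zin A y v)"
    using xy v zinbiel by (simp add: subadjacent_def rules add.commute)
  show "prl A (brk ?R x y) v = prl A x (prl A y v) - prl A y (prl A x v)"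
    using xy v pre_lie[of x y v] by (simp add: subadjacent_def rules algebra_simps)
  show "pder A (zin A x v) = zin A (der ?R x) v + zin A x (pder A v)"
    using xy v der_zin by (simp add: subadjacent_def is_derivation_def)
  show "pder A (prl A x v) = prl A (der ?R x) v + prl A x (pder A v)"
    using xy v der_prl by (simp add: subadjacent_def is_derivation_def)
  show "prl A y (zin A x v) = zin A x (prl A y v) + zin A (brk ?R y x) v + zin A (mul ?R x (der ?R y)) v"
    using xy v compat2[of x y v] by (simp add: subadjacent_def rules algebra_simps)
  show "prl A (mul ?R x y) v = zin A x (prl A y v) + zin A y (prl A x v) - zin A (mul ?R x y) (pder A v)"
    using xy v compat1[of x y v] by (simp add: subadjacent_def rules algebra_simps)
qed

end

section \<open>Transport of structure, Jacobi algebras and coalgebras\<close>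

text \<open>
  All axioms are equations, so they can be checked after an injective map that respects the
  operations. It is used both for the graph of \<open>R\<close> and for the shear.
\<close>
lemma relative_poisson_algebra_embedding:
  fixes J :: "('k::field, 'v::ab_group_add, 'm) rpa_scheme"
    and S :: "('k, 'w::ab_group_add, 'n) rpa_scheme"
  assumes "fd_space J" "relative_poisson_algebra S"
    and lin: "lin_map J S \<Phi>" and inj: "inj_on \<Phi> (car J)"
    and mul: "\<And>x y. x \<in> car J \<Longrightarrow> y \<in> car J \<Longrightarrow>
      mul J x y \<in> car J \<and> \<Phi> (mul J x y) = mul S (\<Phi> x) (\<Phi> y)"
    and brk: "\<And>x y. x \<in> car J \<Longrightarrow> y \<in> car J \<Longrightarrow>
      brk J x y \<in> car J \<and> \<Phi> (brk J x y) = brk S (\<Phi> x) (\<Phi> y)"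
    and der: "\<And>x. x \<in> car J \<Longrightarrow> der J x \<in> car J \<and> \<Phi> (der J x) = der S (\<Phi> x)"
  shows "relative_poisson_algebra J"
proof -
  interpret J: fd_space J by fact
  interpret S: relative_poisson_algebra S by fact
  note rules = J.lin_map_rules[OF lin] J.car_rules S.mul_rules S.brk_rules S.der_rules
    S.vector_space_rules
  have closed: "mul J x y \<in> car J" "brk J x y \<in> car J" "der J x \<in> car J"
    if "x \<in> car J" "y \<in> car J" for x y
    using that mul brk der by simp_all
  have image: "\<Phi> (mul J x y) = mul S (\<Phi> x) (\<Phi> y)" "\<Phi> (brk J x y) = brk S (\<Phi> x) (\<Phi> y)"
    "\<Phi> (der J x) = der S (\<Phi> x)"
    if "x \<in> car J" "y \<in> car J" for x y
    using that mul brk der by simp_all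
  note all = rules closed image mul brk der
  have eq: "x = y" if "\<Phi> x = \<Phi> y" "x \<in> car J" "y \<in> car J" for x y
    using inj that by (simp add: inj_on_eq_iff)
  show ?thesis
  proof (intro relative_poisson_algebra.intro relative_poisson_algebra_axioms.intro comm_lieI)
    show "fd_space J" by fact
    show "bilin_map J J (mul J)" "bilin_map J J (brk J)"
      by (auto simp: bilin_map_def lin_map_def all intro!: eq)
    show "is_derivation J (mul J) (der J)" "is_derivation J (brk J) (der J)"
      by (auto simp: is_derivation_def lin_map_def all S.der_mul_apply S.der_brk_apply intro!: eq)
    fix x y z assume "x \<in> car J" "y \<in> car J" "z \<in> car J"
    note all = all this
    show "mul J x y = mul J y x"
      by (rule eq) (simp_all add: all S.mul_comm)
    show "mul J (mul J x y) z = mul J x (mul J y z)"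
      by (rule eq) (simp_all add: all S.mul_assoc)
    show "brk J x x = 0"
      by (rule eq) (simp_all add: all S.brk_alt)
    show "brk J x (brk J y z) + brk J y (brk J z x) + brk J z (brk J x y) = 0"
      by (rule eq) (simp_all add: all S.jacobi)
    show "brk J z (mul J x y) =
        mul J (brk J z x) y + mul J x (brk J z y) + mul J (mul J x y) (der J z)"
      by (rule eq) (simp_all add: all S.leibniz)
  qed
qed

text \<open>The Leibniz rule for \<open>[z, 1 \<cdot> 1]\<close> gives \<open>[z, 1] = 2 [z, 1] + P z\<close>.\<close>
lemma (in relative_poisson_algebra) der_unit:
  assumes u: "is_unit R u" and z: "z \<in> car R"
  shows "der R z = brk R u z"
proof -
  have uc: "u \<in> car R" and uu: "mul R u u = u"
    and unit: "\<And>x. x \<in> car R \<Longrightarrow> mul R u x = x" "\<And>x. x \<in> car R \<Longrightarrow> mul R x u = x"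
    using u by (auto simp: is_unit_def)
  have "brk R z u = brk R z u + brk R z u + der R z"
    using leibniz[OF uc uc z] uc z by (simp add: uu unit brk_rules der_rules)
  then have "der R z = - brk R z u" by (simp add: eq_neg_iff_add_eq_0 add.commute)
  then show ?thesis using brk_antisym[OF uc z] by simp
qed

lemma (in relative_poisson_algebra) unital_jacobi:
  assumes "is_unit R u" shows "jacobi_algebra R u"
  using assms leibniz der_unit[OF assms] comm_lie_axioms
  by (intro jacobi_algebra.intro jacobi_algebra_axioms.intro) simp_all

text \<open>
  Because tensors are functions on the dual space, each coalgebra axiom at \<open>(f, g, h)\<close> reads off an
  identity between iterated products of \<open>f, g, h\<close> in \<open>V\<^sup>*\<close>, evaluated at the point \<open>x\<close>:
  \<open>id \<otimes> \<Delta>\<close> after \<open>\<delta>\<close> is \<open>[f, g \<cdot> h]\<close>, \<open>\<delta> \<otimes> id\<close> after \<open>\<Delta>\<close> is \<open>[f, g] \<cdot> h\<close>, and so on.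
\<close>
lemma (in fd_space) relative_poisson_coalgebraI:
  assumes \<Delta>: "lin_map V (tensor2 V) \<Delta>" and \<delta>: "lin_map V (tensor2 V) \<delta>" and Q: "lin_map V V Q"
    and \<Delta>_ext: "\<And>x f g. x \<in> car V \<Longrightarrow> \<not> (f \<in> car (dualsp V) \<and> g \<in> car (dualsp V)) \<Longrightarrow> \<Delta> x f g = 0"
    and \<delta>_ext: "\<And>x f g. x \<in> car V \<Longrightarrow> \<not> (f \<in> car (dualsp V) \<and> g \<in> car (dualsp V)) \<Longrightarrow> \<delta> x f g = 0"
    and dual: "relative_poisson_algebra (dual_rpa V \<Delta> \<delta> Q)"
  shows "relative_poisson_coalgebra V \<Delta> \<delta> Q"
proof -
  let ?D = "dual_rpa V \<Delta> \<delta> Q"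
  interpret D: relative_poisson_algebra ?D by (fact dual)
  have car: "car ?D = car (dualsp V)" by (simp add: dual_rpa_def)
  have der: "der ?D = dual_map V Q" by (simp add: dual_rpa_def)
  have mul_fold: "restr V (\<lambda>x. \<Delta> x f g) = mul ?D f g" 
    and brk_fold: "restr V (\<lambda>x. \<delta> x f g) = brk ?D f g" for f g
    by (simp_all add: dual_rpa_def)
  have \<Delta>_apply: "\<Delta> x f g = mul ?D f g x" and \<delta>_apply: "\<delta> x f g = brk ?D f g x"
    if "x \<in> car V" for x f g
    using that by (simp_all add: dual_rpa_def restr_def)
  have der_apply: "f (Q x) = der ?D f x" if "x \<in> car V" for x f
    using that by (simp add: der dual_map_apply)
  have closed: "mul ?D f g \<in> car (dualsp V)" "brk ?D f g \<in> car (dualsp V)" "der ?D f \<in> car (dualsp V)"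
    if "f \<in> car (dualsp V)" "g \<in> car (dualsp V)" for f g
    using that D.mul_rules(1) D.brk_rules(1) D.der_rules(1) by (simp_all add: car)
  have Q_in: "x \<in> car V \<Longrightarrow> Q x \<in> car V" for x using Q by (simp add: lin_map_def)
  have id: "dual_map V id f = f" if "f \<in> car (dualsp V)" for f
    using that by (auto simp: fun_eq_iff dual_map_apply dual_rules)
  note ops = cop_left_def cop_right_def flip2_def flip12_def cycle3_def tmap2_def tmap3_def
    ext2_def ext3_def der[symmetric] mul_fold brk_fold id closed Q_in
  show ?thesis
  proof (intro relative_poisson_coalgebra.intro relative_poisson_coalgebra_axioms.intro)
    show "fd_space V" "lin_map V (tensor2 V) \<Delta>" "lin_map V (tensor2 V) \<delta>" "lin_map V V Q"
      by (fact fd_space_axioms \<Delta> \<delta> Q)+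
    fix x assume x: "x \<in> car V"
    have t2: "s = t" if "\<And>f g. f \<in> car (dualsp V) \<Longrightarrow> g \<in> car (dualsp V) \<Longrightarrow> s f g = t f g"
      "\<And>f g. \<not> (f \<in> car (dualsp V) \<and> g \<in> car (dualsp V)) \<Longrightarrow> s f g = t f g"
    for s t :: "('k, 'v) tensor2"
      using that by (intro ext) blast
    have t3: "s = t" if "\<And>f g h. f \<in> car (dualsp V) \<Longrightarrow> g \<in> car (dualsp V) \<Longrightarrow> h \<in> car (dualsp V) \<Longrightarrow>
        s f g h = t f g h"
      "\<And>f g h. \<not> (f \<in> car (dualsp V) \<and> g \<in> car (dualsp V) \<and> h \<in> car (dualsp V)) \<Longrightarrow> s f g h = t f g h"
    for s t :: "('k, 'v) tensor3"
      using that by (intro ext) blast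
    show "flip2 (\<Delta> x) = \<Delta> x"
      by (rule t2) (use x in \<open>auto simp: flip2_def \<Delta>_apply D.mul_comm car \<Delta>_ext[OF x, unfolded \<Delta>_apply[OF x]]\<close>)
    show "flip2 (\<delta> x) = - \<delta> x"
    proof (rule t2)
      fix f g assume "f \<in> car (dualsp V)" "g \<in> car (dualsp V)"
      then show "flip2 (\<delta> x) f g = (- \<delta> x) f g"
        using D.brk_antisym[of g f] by (simp add: flip2_def \<delta>_apply x car)
    qed (auto simp: flip2_def \<delta>_ext x)
    show "cop_right V \<Delta> (\<Delta> x) = cop_left V \<Delta> (\<Delta> x)"
      by (rule t3) (use x in \<open>auto simp: ops \<Delta>_apply D.mul_assoc car\<close>)
    show "cop_right V \<delta> (\<delta> x) + cycle3 (cop_right V \<delta> (\<delta> x))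
            + cycle3 (cycle3 (cop_right V \<delta> (\<delta> x))) = 0"
    proof (rule t3)
      fix f g h assume "f \<in> car (dualsp V)" "g \<in> car (dualsp V)" "h \<in> car (dualsp V)"
      then show "(cop_right V \<delta> (\<delta> x) + cycle3 (cop_right V \<delta> (\<delta> x))
            + cycle3 (cycle3 (cop_right V \<delta> (\<delta> x)))) f g h = 0 f g h"
        using fun_cong[OF D.jacobi[of f g h], of x] x
        by (simp add: ops \<delta>_apply car algebra_simps)
    qed (auto simp: ops)
    show "\<Delta> (Q x) = tmap2 V Q id (\<Delta> x) + tmap2 V id Q (\<Delta> x)"
    proof (rule t2)
      fix f g assume "f \<in> car (dualsp V)" "g \<in> car (dualsp V)"
      then show "\<Delta> (Q x) f g = (tmap2 V Q id (\<Delta> x) + tmap2 V id Q (\<Delta> x)) f g"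
        using x by (simp add: ops \<Delta>_apply der_apply D.der_mul_apply car)
    qed (auto simp: ops \<Delta>_ext x)
    show "\<delta> (Q x) = tmap2 V Q id (\<delta> x) + tmap2 V id Q (\<delta> x)"
    proof (rule t2)
      fix f g assume "f \<in> car (dualsp V)" "g \<in> car (dualsp V)"
      then show "\<delta> (Q x) f g = (tmap2 V Q id (\<delta> x) + tmap2 V id Q (\<delta> x)) f g"
        using x by (simp add: ops \<delta>_apply der_apply D.der_brk_apply car)
    qed (auto simp: ops \<delta>_ext x)
    show "cop_right V \<Delta> (\<delta> x) - cop_left V \<delta> (\<Delta> x) - flip12 (cop_right V \<delta> (\<Delta> x))
            - tmap3 V Q id id (cop_left V \<Delta> (\<Delta> x)) = 0"
    proof (rule t3)
      fix f g h assume fgh: "f \<in> car (dualsp V)" "g \<in> car (dualsp V)" "h \<in> car (dualsp V)"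
      have "mul ?D (mul ?D g h) (der ?D f) = mul ?D (mul ?D (der ?D f) g) h"
        using fgh D.mul_comm[of "mul ?D g h" "der ?D f"] by (simp add: D.mul_assoc car closed)
      then show "(cop_right V \<Delta> (\<delta> x) - cop_left V \<delta> (\<Delta> x) - flip12 (cop_right V \<delta> (\<Delta> x))
            - tmap3 V Q id id (cop_left V \<Delta> (\<Delta> x))) f g h = 0 f g h"
        using fgh x by (simp add: ops \<Delta>_apply \<delta>_apply D.leibniz car)
    qed (auto simp: ops)
  qed
qed

section \<open>The bialgebra and the double of a skew operator\<close>

text \<open>
  These are the conditions on an antisymmetric tensor to solve the \<open>(-P)\<close>-Yang-Baxter equation,
  written for the operator \<open>R\<close> with \<open>r(f, g) = g (R f)\<close>.
\<close>
locale rpybe_operator = relative_poisson_algebra D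
  for D :: "('k::field, 'v::ab_group_add, 'm) rpa_scheme" +
  fixes R :: "('v \<Rightarrow> 'k) \<Rightarrow> 'v"
  assumes R_lin: "lin_map (dualsp D) D R"
    and R_skew: "f \<in> car (dualsp D) \<Longrightarrow> g \<in> car (dualsp D) \<Longrightarrow> g (R f) = - f (R g)"
    and R_mul: "f \<in> car (dualsp D) \<Longrightarrow> g \<in> car (dualsp D) \<Longrightarrow> h \<in> car (dualsp D) \<Longrightarrow>
          f (mul D (R g) (R h)) + g (mul D (R h) (R f)) + h (mul D (R f) (R g)) = 0"
    and R_brk: "f \<in> car (dualsp D) \<Longrightarrow> g \<in> car (dualsp D) \<Longrightarrow> h \<in> car (dualsp D) \<Longrightarrow>
          f (brk D (R g) (R h)) + g (brk D (R h) (R f)) + h (brk D (R f) (R g)) = 0"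
    and R_der: "f \<in> car (dualsp D) \<Longrightarrow> R (dual_map D (der D) f) = - der D (R f)"
begin

sublocale dual: fd_space "dualsp D" by (rule dual_fd_space)

definition tensor :: "('k, 'v) tensor2" where
  "tensor = ext2 D (\<lambda>f g. g (R f))"

definition \<Delta> :: "'v \<Rightarrow> ('k, 'v) tensor2" where
  "\<Delta> u = tmap2 D id (mul D u) tensor - tmap2 D (mul D u) id tensor"

definition \<delta> :: "'v \<Rightarrow> ('k, 'v) tensor2" where
  "\<delta> u = tmap2 D (brk D u) id tensor + tmap2 D id (brk D u) tensor"

definition Q :: "'v \<Rightarrow> 'v" where
  "Q = (\<lambda>x. - der D x)"

lemmas R_rules = dual.lin_map_rules[OF R_lin]
lemmas all_rules = mul_rules brk_rules der_rules car_rules vector_space_rules R_rules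

lemma mul_lin: "x \<in> car D \<Longrightarrow> lin_map D D (mul D x)"
  and brk_lin: "x \<in> car D \<Longrightarrow> lin_map D D (brk D x)"
  and Q_lin: "lin_map D D Q"
  by (simp_all add: lin_map_def Q_def all_rules)

lemma dual_map_id: "f \<in> car (dualsp D) \<Longrightarrow> dual_map D id f = f"
  by (auto simp: fun_eq_iff dual_map_apply dual_rules)

lemma dual_map_closed:
  assumes "f \<in> car (dualsp D)"
  shows "x \<in> car D \<Longrightarrow> dual_map D (mul D x) f \<in> car (dualsp D)"
    and "x \<in> car D \<Longrightarrow> dual_map D (brk D x) f \<in> car (dualsp D)"
    and "dual_map D (der D) f \<in> car (dualsp D)"
    and "dual_map D Q f \<in> car (dualsp D)"
  using assms by (auto intro: dual_map_in_dual mul_lin brk_lin der_lin Q_lin)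

lemma R_transpose:
  assumes "lin_map D D T" "f \<in> car (dualsp D)" "g \<in> car (dualsp D)"
  shows "g (R (dual_map D T f)) = - f (T (R g))"
  using R_skew[OF dual_map_in_dual[OF assms(1,2)] assms(3)] assms(3)
  by (simp add: dual_map_apply R_rules)

text \<open>
  The cancellation behind every bialgebra condition: operators on both sides of \<open>R\<close> exchange their
  functionals at the price of a sign.
\<close>
lemma R_transpose_swap:
  assumes S: "lin_map D D S" and T: "lin_map D D T"
    and f: "f \<in> car (dualsp D)" and g: "g \<in> car (dualsp D)"
  shows "g (S (R (dual_map D T f))) = - f (T (R (dual_map D S g)))"
proof -
  have "g (S (R (dual_map D T f))) = dual_map D S g (R (dual_map D T f))"
    using dual_map_in_dual[OF T f] by (simp add: dual_map_apply R_rules)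
  then show ?thesis using R_transpose[OF T f dual_map_in_dual[OF S g]] by simp
qed

lemma tensor_apply:
  "f \<in> car (dualsp D) \<Longrightarrow> g \<in> car (dualsp D) \<Longrightarrow> tensor f g = g (R f)"
  by (simp add: tensor_def ext2_def)

lemma \<Delta>_ext2: "u \<in> car D \<Longrightarrow> \<Delta> u = ext2 D (\<lambda>f g. g (mul D u (R f)) + f (mul D u (R g)))"
  by (auto simp: fun_eq_iff \<Delta>_def tmap2_def ext2_def tensor_apply dual_map_id dual_map_closed
      dual_map_apply R_rules R_transpose mul_lin)

lemma \<delta>_ext2: "u \<in> car D \<Longrightarrow> \<delta> u = ext2 D (\<lambda>f g. g (brk D u (R f)) - f (brk D u (R g)))"
  by (auto simp: fun_eq_iff \<delta>_def tmap2_def ext2_def tensor_apply dual_map_id dual_map_closed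
      dual_map_apply R_rules R_transpose brk_lin)

lemma \<Delta>_apply:
  "u \<in> car D \<Longrightarrow> f \<in> car (dualsp D) \<Longrightarrow> g \<in> car (dualsp D) \<Longrightarrow>
    \<Delta> u f g = g (mul D u (R f)) + f (mul D u (R g))"
  by (simp add: \<Delta>_ext2 ext2_def)

lemma \<delta>_apply:
  "u \<in> car D \<Longrightarrow> f \<in> car (dualsp D) \<Longrightarrow> g \<in> car (dualsp D) \<Longrightarrow>
    \<delta> u f g = g (brk D u (R f)) - f (brk D u (R g))"
  by (simp add: \<delta>_ext2 ext2_def)

text \<open>\<open>\<Delta> u\<close> is the tensor of the operator \<open>f \<mapsto> u \<cdot> R f - R (f \<circ> L\<^sub>u)\<close>; similarly for \<open>\<delta> u\<close>.\<close>
lemma \<Delta>_lin: "lin_map D (tensor2 D) \<Delta>"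
proof -
  have "\<Delta> u \<in> car (tensor2 D)" if u: "u \<in> car D" for u
  proof -
    have "\<Delta> u = ext2 D (\<lambda>f g. g (mul D u (R f) - R (dual_map D (mul D u) f)))"
      using u by (auto simp: \<Delta>_ext2 ext2_def fun_eq_iff dual_rules all_rules dual_map_closed
          R_transpose mul_lin)
    also have "\<dots> \<in> car (tensor2 D)"
      using u dual.lin_map_rules[OF dual_map_lin[OF mul_lin[OF u]]]
      by (intro operator_in_tensor2) (simp add: lin_map_def all_rules)
    finally show ?thesis .
  qed
  then show ?thesis
    by (auto simp: lin_map_def \<Delta>_ext2 ext2_def fun_eq_iff all_rules dual_rules tensor2_def scl2_def
        algebra_simps)
qed

lemma \<delta>_lin: "lin_map D (tensor2 D) \<delta>"
proof -
  have "\<delta> u \<in> car (tensor2 D)" if u: "u \<in> car D" for u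
  proof -
    have "\<delta> u = ext2 D (\<lambda>f g. g (brk D u (R f) + R (dual_map D (brk D u) f)))"
      using u by (auto simp: \<delta>_ext2 ext2_def fun_eq_iff dual_rules all_rules dual_map_closed
          R_transpose brk_lin)
    also have "\<dots> \<in> car (tensor2 D)"
      using u dual.lin_map_rules[OF dual_map_lin[OF brk_lin[OF u]]]
      by (intro operator_in_tensor2) (simp add: lin_map_def all_rules)
    finally show ?thesis .
  qed
  then show ?thesis
    by (auto simp: lin_map_def \<delta>_ext2 ext2_def fun_eq_iff all_rules dual_rules tensor2_def scl2_def
        algebra_simps)
qed

lemma antisymmetric_tensor: "antisymmetric tensor"
proof -
  have "tensor f g + tensor g f = 0" for f g
    using R_skew[of f g] by (auto simp: tensor_def ext2_def)
  then show ?thesis by (simp add: antisymmetric_def flip2_def fun_eq_iff)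
qed

text \<open>
  Contracting one slot of \<open>r\<close> with a functional gives \<open>R\<close>, up to a sign for the second slot. Hence
  \<open>r\<^sub>1\<^sub>2 \<diamond> r\<^sub>1\<^sub>3\<close>, \<open>r\<^sub>1\<^sub>2 \<diamond> r\<^sub>2\<^sub>3\<close> and \<open>r\<^sub>1\<^sub>3 \<diamond> r\<^sub>2\<^sub>3\<close> at \<open>(f, g, h)\<close> are
  \<open>f (R g \<diamond> R h)\<close>, \<open>- g (R f \<diamond> R h)\<close> and \<open>h (R f \<diamond> R g)\<close>.
\<close>
lemma tensor_rpybe: "rpybe_solution D Q tensor"
proof -
  have left: "restr D (\<lambda>x. tensor (restr D (\<lambda>y. f (b x y))) h) = restr D (\<lambda>x. - f (b x (R h)))"
    and right: "restr D (\<lambda>x. tensor g (restr D (\<lambda>y. f (b x y)))) = restr D (\<lambda>x. f (b x (R g)))"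
    if b: "bilin_map D D b" and fh: "f \<in> car (dualsp D)" "h \<in> car (dualsp D)" "g \<in> car (dualsp D)"
    for b f g h
  proof (rule_tac[!] restr_cong)
    fix x assume x: "x \<in> car D"
    let ?k = "restr D (\<lambda>y. f (b x y))"
    have k: "?k \<in> car (dualsp D)" using restr_op_in_dual[OF b fh(1) x] .
    show "tensor ?k h = - f (b x (R h))"
      using R_skew[OF k fh(2)] fh k by (simp add: tensor_apply restr_apply R_rules)
    show "tensor g ?k = f (b x (R g))"
      using fh k by (simp add: tensor_apply restr_apply R_rules)
  qed
  have left_dual: "restr D (\<lambda>x. - f (b x (R h))) \<in> car (dualsp D)"
    and right_dual: "restr D (\<lambda>x. f (b x (R h))) \<in> car (dualsp D)"
    if b: "bilin_map D D b" and fh: "f \<in> car (dualsp D)" "h \<in> car (dualsp D)" for b f h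
    using fh bilin_maps_rules[OF fd_space_axioms fd_space_axioms b[unfolded bilin_map_iff]]
    by (auto intro!: restr_in_dual simp: lin_map_def ground_def dual_rules R_rules)
  have left_R: "g (R (restr D (\<lambda>x. - f (b x (R h))))) = f (b (R g) (R h))"
    if b: "bilin_map D D b" and fgh: "f \<in> car (dualsp D)" "g \<in> car (dualsp D)" "h \<in> car (dualsp D)"
    for b f g h
    using R_skew[OF left_dual[OF b fgh(1,3)] fgh(2)] fgh by (simp add: restr_apply R_rules)
  have r: "r12_13 D b tensor = ext3 D (\<lambda>f g h. f (b (R g) (R h)))"
    "r12_23 D b tensor = ext3 D (\<lambda>f g h. - g (b (R f) (R h)))"
    "r13_23 D b tensor = ext3 D (\<lambda>f g h. h (b (R f) (R g)))"
    if b: "bilin_map D D b" for b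
    by (auto simp: r12_13_def r12_23_def r13_23_def ext3_def fun_eq_iff left[OF b] right[OF b] left_R[OF b]
        tensor_apply left_dual[OF b] right_dual[OF b] restr_apply R_rules)
  show ?thesis
    unfolding rpybe_solution_def
  proof (intro conjI)
    show "tensor \<in> car (tensor2 D)"
      unfolding tensor_def by (rule operator_in_tensor2[OF R_lin])
    show "lin_map D D Q" by (rule Q_lin)
    show "r12_13 D (mul D) tensor - r12_23 D (mul D) tensor + r13_23 D (mul D) tensor = 0"
      using R_mul by (auto simp: r[OF mul_bilin] ext3_def fun_eq_iff mul_comm R_rules)
    have "- brk D (R f) (R h) = brk D (R h) (R f)" if "f \<in> car (dualsp D)" "h \<in> car (dualsp D)" for f h
      using that brk_antisym[of "R h" "R f"] by (simp add: R_rules)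
    then have "- g (brk D (R f) (R h)) = g (brk D (R h) (R f))"
      if "f \<in> car (dualsp D)" "g \<in> car (dualsp D)" "h \<in> car (dualsp D)" for f g h
      using that dual_rules(4)[of g "brk D (R f) (R h)"] by (simp add: all_rules)
    then show "r12_13 D (brk D) tensor + r12_23 D (brk D) tensor + r13_23 D (brk D) tensor = 0"
      using R_brk by (auto simp: r[OF brk_bilin] ext3_def fun_eq_iff)
    have der_swap: "g (der D (R f)) = f (der D (R g))"
      if "f \<in> car (dualsp D)" "g \<in> car (dualsp D)" for f g
      using R_transpose[OF der_lin that] that by (simp add: R_der dual_rules all_rules)
    show "tmap2 D (der D) id tensor - tmap2 D id Q tensor = 0"
      "tmap2 D Q id tensor - tmap2 D id (der D) tensor = 0"
      by (auto simp: fun_eq_iff tmap2_def ext2_def tensor_apply dual_map_id dual_map_closed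
          dual_map_apply R_rules R_transpose der_lin Q_lin)
        (auto simp: Q_def dual_rules all_rules der_swap)
  qed
qed

text \<open>The semidirect product \<open>D \<ltimes> D\<^sup>*\<close> along the dual of the adjoint representation.\<close>
definition double :: "('k, 'v \<times> ('v \<Rightarrow> 'k)) rpa" where
  "double = semidirect D (dualsp D) (\<lambda>x u. - dual_rep D (mul D) x u) (dual_rep D (brk D))
     (\<lambda>u. - dual_map D (der D) u)"

lemma double_rpa: "relative_poisson_algebra double"
proof -
  interpret adjoint: rpa_representation D D "mul D" "brk D" "der D"
    by (rule adjoint_representation)
  interpret coadjoint: rpa_representation D "dualsp D" "\<lambda>x u. - dual_rep D (mul D) x u"
    "dual_rep D (brk D)" "\<lambda>u. - dual_map D (der D) u"
    by (rule adjoint.dual_representation)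
  show ?thesis unfolding double_def by (rule coadjoint.semidirect_rpa)
qed

text \<open>The structure on \<open>D\<^sup>*\<close> transposed from \<open>\<Delta>\<close>, \<open>\<delta>\<close> and \<open>Q\<close>.\<close>
abbreviation star :: "('k, 'v \<Rightarrow> 'k) rpa" where
  "star \<equiv> dual_rpa D \<Delta> \<delta> Q"

text \<open>
  The second claim identifies the product with the \<open>D\<^sup>*\<close>-component of \<open>(R f, f) \<cdot> (R g, g)\<close> in
  \<open>D \<ltimes> D\<^sup>*\<close>. Pairing with \<open>h\<close> and moving \<open>R\<close> to \<open>h\<close> turns the third claim into the cyclic identity.
\<close>
lemma star_mul:
  assumes f: "f \<in> car (dualsp D)" and g: "g \<in> car (dualsp D)"
  shows "mul star f g \<in> car (dualsp D)"
    and "x \<in> car D \<Longrightarrow> mul star f g x = g (mul D (R f) x) + f (mul D (R g) x)"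
    and "R (mul star f g) = mul D (R f) (R g)"
proof -
  have app: "mul star f g x = g (mul D (R f) x) + f (mul D (R g) x)" if "x \<in> car D" for x
    using that f g by (simp add: dual_rpa_def restr_apply \<Delta>_apply mul_comm R_rules)
  then show "x \<in> car D \<Longrightarrow> mul star f g x = g (mul D (R f) x) + f (mul D (R g) x)" .
  show closed: "mul star f g \<in> car (dualsp D)"
    by (simp add: dual_rpa_def restr_cop_in_dual \<Delta>_lin)
  show "R (mul star f g) = mul D (R f) (R g)"
  proof (rule dual_separates)
    fix h assume h: "h \<in> car (dualsp D)"
    have "h (R (mul star f g)) = - (g (mul D (R f) (R h)) + f (mul D (R g) (R h)))"
      using R_skew[OF closed h] h by (simp add: app R_rules)
    also have "\<dots> = h (mul D (R f) (R g))"
      using R_mul[OF f g h] f h mul_comm[of "R f" "R h"]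
      by (intro minus_unique) (simp add: R_rules add_ac)
    finally show "h (R (mul star f g)) = h (mul D (R f) (R g))" .
  qed (use f g closed in \<open>simp_all add: all_rules\<close>)
qed

lemma star_brk:
  assumes f: "f \<in> car (dualsp D)" and g: "g \<in> car (dualsp D)"
  shows "brk star f g \<in> car (dualsp D)"
    and "x \<in> car D \<Longrightarrow> brk star f g x = f (brk D (R g) x) - g (brk D (R f) x)"
    and "R (brk star f g) = brk D (R f) (R g)"
proof -
  have anti: "h (brk D x y) = - h (brk D y x)" if "h \<in> car (dualsp D)" "x \<in> car D" "y \<in> car D" for h x y
    using that brk_antisym[of x y] by (simp add: dual_rules brk_rules)
  have app: "brk star f g x = f (brk D (R g) x) - g (brk D (R f) x)" if "x \<in> car D" for x
    using that f g anti[of f "R g" x] anti[of g "R f" x]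
    by (simp add: dual_rpa_def restr_apply \<delta>_apply R_rules)
  then show "x \<in> car D \<Longrightarrow> brk star f g x = f (brk D (R g) x) - g (brk D (R f) x)" .
  show closed: "brk star f g \<in> car (dualsp D)"
    by (simp add: dual_rpa_def restr_cop_in_dual \<delta>_lin)
  show "R (brk star f g) = brk D (R f) (R g)"
  proof (rule dual_separates)
    fix h assume h: "h \<in> car (dualsp D)"
    have "h (R (brk star f g)) = - (f (brk D (R g) (R h)) - g (brk D (R f) (R h)))"
      using R_skew[OF closed h] h by (simp add: app R_rules)
    also have "\<dots> = h (brk D (R f) (R g))"
      using R_brk[OF f g h] f g h anti[of g "R h" "R f"]
      by (simp add: R_rules) (simp add: algebra_simps)
    finally show "h (R (brk star f g)) = h (brk D (R f) (R g))" .
  qed (use f g closed in \<open>simp_all add: all_rules\<close>)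
qed

lemma star_der:
  assumes f: "f \<in> car (dualsp D)"
  shows "der star f = - dual_map D (der D) f" and "der star f \<in> car (dualsp D)"
    and "R (der star f) = der D (R f)"
proof -
  show eq: "der star f = - dual_map D (der D) f"
    using f by (auto simp: dual_rpa_def fun_eq_iff dual_map_apply Q_def dual_rules der_rules)
  show "der star f \<in> car (dualsp D)" by (simp add: dual_rpa_def dual_map_closed f)
  show "R (der star f) = der D (R f)"
    using f by (simp add: eq R_rules dual_map_closed R_der)
qed

text \<open>The graph of \<open>R\<close> is a subalgebra of \<open>D \<ltimes> D\<^sup>*\<close>, and it projects bijectively to \<open>D\<^sup>*\<close>.\<close>
lemma star_rpa: "relative_poisson_algebra star"
proof (rule relative_poisson_algebra_embedding[OF _ double_rpa])
  show "fd_space star"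
    using dual.ambient dual.subspace_car dual.fin_dim
    by (intro fd_space.intro) (simp_all add: dual_rpa_def)
  show "lin_map star double (\<lambda>f. (R f, f))"
    by (auto simp: lin_map_def dual_rpa_def double_def semidirect_def R_rules)
  show "inj_on (\<lambda>f. (R f, f)) (car star)" by (simp add: inj_on_def)
  fix f assume "f \<in> car star"
  then have f: "f \<in> car (dualsp D)" by (simp add: dual_rpa_def)
  show "der star f \<in> car star \<and> (R (der star f), der star f) = der double (R f, f)"
    using star_der[OF f] by (simp add: double_def semidirect_def) (simp add: dual_rpa_def)
  fix g assume "g \<in> car star"
  then have g: "g \<in> car (dualsp D)" by (simp add: dual_rpa_def)
  have car: "car star = car (dualsp D)" by (simp add: dual_rpa_def)
  have "mul star f g = - dual_rep D (mul D) (R f) g + - dual_rep D (mul D) (R g) f"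
    using star_mul(2)[OF f g] dual_rules(6)[OF star_mul(1)[OF f g]]
    by (auto simp: fun_eq_iff dual_rep_apply)
  then show "mul star f g \<in> car star \<and>
      (R (mul star f g), mul star f g) = mul double (R f, f) (R g, g)"
    using star_mul[OF f g] by (simp add: double_def semidirect_def car)
  have "brk star f g = dual_rep D (brk D) (R f) g - dual_rep D (brk D) (R g) f"
    using star_brk(2)[OF f g] dual_rules(6)[OF star_brk(1)[OF f g]]
    by (auto simp: fun_eq_iff dual_rep_apply)
  then show "brk star f g \<in> car star \<and>
      (R (brk star f g), brk star f g) = brk double (R f, f) (R g, g)"
    using star_brk[OF f g] by (simp add: double_def semidirect_def car)
qed

lemma coalgebra: "relative_poisson_coalgebra D \<Delta> \<delta> Q"
  by (rule relative_poisson_coalgebraI[OF \<Delta>_lin \<delta>_lin Q_lin _ _ star_rpa])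
    (auto simp: \<Delta>_ext2 \<delta>_ext2 ext2_def)

text \<open>
  For \<open>Q = -P\<close> the first two conditions are the derivation property, and the third is the Leibniz
  rule \<open>\<rho>_mul_dual\<close> of the adjoint representation.
\<close>
lemma dually_rep: "dually_represents D Q"
  unfolding dually_represents_def
proof (intro conjI ballI)
  interpret adjoint: rpa_representation D D "mul D" "brk D" "der D"
    by (rule adjoint_representation)
  show "lin_map D D Q" by (rule Q_lin)
  fix x y assume xy: "x \<in> car D" "y \<in> car D"
  show "mul D x (Q y) - mul D (der D x) y - Q (mul D x y) = 0"
    "brk D x (Q y) - brk D (der D x) y - Q (brk D x y) = 0"
    using xy by (simp_all add: Q_def der_mul_apply der_brk_apply all_rules)
  fix z assume z: "z \<in> car D"
  show "brk D x (mul D y z) + brk D y (mul D z x) + brk D z (mul D x y) + Q (mul D (mul D x y) z) = 0"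
    using xy z brk_antisym[of z "mul D x y"] adjoint.\<rho>_mul_dual[OF xy z] mul_comm[OF z xy(1)]
    by (simp add: Q_def all_rules)
qed

text \<open>
  At a pair \<open>(f, g)\<close> each condition splits into terms in which \<open>R\<close> is applied innermost, to \<open>f\<close> or to
  \<open>g\<close>, and terms with \<open>R\<close> between two multiplications. The latter cancel by \<open>R_transpose_swap\<close>; the
  former are one Leibniz, associativity or Jacobi identity of \<open>D\<close> for each of \<open>f\<close> and \<open>g\<close>. The
  condition on \<open>P + Q\<close> holds because \<open>P + Q = 0\<close>.
\<close>
lemma bialgebra: "relative_poisson_bialgebra D \<Delta> \<delta> Q"
proof (intro relative_poisson_bialgebra.intro relative_poisson_bialgebra_axioms.intro)
  interpret adjoint: rpa_representation D D "mul D" "brk D" "der D"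
    by (rule adjoint_representation)
  have tensor_eqI: "s = t"
    if "\<And>f g. f \<in> car (dualsp D) \<Longrightarrow> g \<in> car (dualsp D) \<Longrightarrow> s f g = t f g"
      "\<And>f g. \<not> (f \<in> car (dualsp D) \<and> g \<in> car (dualsp D)) \<Longrightarrow> s f g = t f g"
    for s t :: "('k, 'v) tensor2"
    using that by (intro ext) blast
  note eval = tmap2_def ext2_def \<Delta>_apply \<delta>_apply dual_map_id dual_map_closed dual_map_apply all_rules
  \<comment> \<open>Away from the dual space both sides of every condition vanish.\<close>
  note off = tmap2_def \<Delta>_ext2 \<delta>_ext2 ext2_def all_rules
  show "relative_poisson_algebra D" "relative_poisson_coalgebra D \<Delta> \<delta> Q" "dually_represents D Q"
    by (fact relative_poisson_algebra_axioms coalgebra dually_rep)+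
  have Q_in: "x \<in> car D \<Longrightarrow> Q x \<in> car D" for x by (simp add: Q_def all_rules)
  have RQ: "R (dual_map D Q g) = der D (R g)" if "g \<in> car (dualsp D)" for g
    using star_der[OF that] by (simp add: dual_rpa_def)
  have swap: "g (mul D y (R (dual_map D (mul D x) f))) = - f (mul D x (R (dual_map D (mul D y) g)))"
    "g (mul D y (R (dual_map D (brk D x) f))) = - f (brk D x (R (dual_map D (mul D y) g)))"
    "g (brk D y (R (dual_map D (brk D x) f))) = - f (brk D x (R (dual_map D (brk D y) g)))"
    if "x \<in> car D" "y \<in> car D" "f \<in> car (dualsp D)" "g \<in> car (dualsp D)" for x y f g
    by (intro R_transpose_swap mul_lin brk_lin that)+
  fix x assume x: "x \<in> car D"
  show "\<Delta> (der D x) = tmap2 D (der D) id (\<Delta> x) - tmap2 D id Q (\<Delta> x)"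
  proof (rule tensor_eqI)
    fix f g assume "f \<in> car (dualsp D)" "g \<in> car (dualsp D)"
    then show "\<Delta> (der D x) f g = (tmap2 D (der D) id (\<Delta> x) - tmap2 D id Q (\<Delta> x)) f g"
      using x by (simp add: eval Q_in RQ R_der) (simp add: Q_def dual_rules all_rules der_mul_apply)
  qed (use x in \<open>auto simp: off\<close>)
  show "\<delta> (der D x) = tmap2 D (der D) id (\<delta> x) - tmap2 D id Q (\<delta> x)"
  proof (rule tensor_eqI)
    fix f g assume "f \<in> car (dualsp D)" "g \<in> car (dualsp D)"
    then show "\<delta> (der D x) f g = (tmap2 D (der D) id (\<delta> x) - tmap2 D id Q (\<delta> x)) f g"
      using x by (simp add: eval Q_in RQ R_der) (simp add: Q_def dual_rules all_rules der_brk_apply)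
  qed (use x in \<open>auto simp: off\<close>)
  have "\<Delta> 0 = 0" by (rule lin_map_rules(4)[OF \<Delta>_lin])
  then show "cop_left D \<Delta> (\<Delta> (der D x + Q x)) = 0"
    by (simp add: Q_def cop_left_def ext3_def fun_eq_iff)
  fix y assume y: "y \<in> car D"
  note xy = x y
  show "\<Delta> (mul D x y) = tmap2 D (mul D x) id (\<Delta> y) + tmap2 D id (mul D y) (\<Delta> x)"
  proof (rule tensor_eqI)
    fix f g assume fg: "f \<in> car (dualsp D)" "g \<in> car (dualsp D)"
    have "mul D (mul D x y) z = mul D x (mul D y z)" "mul D y (mul D x z) = mul D x (mul D y z)" if "z \<in> car D" for z
      using that xy by (simp_all add: mul_assoc adjoint.\<sigma>_comm)
    then show "\<Delta> (mul D x y) f g = (tmap2 D (mul D x) id (\<Delta> y) + tmap2 D id (mul D y) (\<Delta> x)) f g"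
      using xy fg swap(1)[OF xy fg] by (simp add: eval)
  qed (use xy in \<open>auto simp: off\<close>)
  show "\<delta> (brk D x y) =
            (tmap2 D (brk D x) id (\<delta> y) + tmap2 D id (brk D x) (\<delta> y))
            - (tmap2 D (brk D y) id (\<delta> x) + tmap2 D id (brk D y) (\<delta> x))"
  proof (rule tensor_eqI)
    fix f g assume fg: "f \<in> car (dualsp D)" "g \<in> car (dualsp D)"
    then show "\<delta> (brk D x y) f g = ((tmap2 D (brk D x) id (\<delta> y) + tmap2 D id (brk D x) (\<delta> y))
            - (tmap2 D (brk D y) id (\<delta> x) + tmap2 D id (brk D y) (\<delta> x))) f g"
      using xy swap(3)[OF xy fg] swap(3)[OF y x fg]
      by (simp add: eval adjoint.\<rho>_brk dual_rules)
  qed (use xy in \<open>auto simp: off\<close>)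
  show "\<delta> (mul D x y) - tmap2 D id (brk D y) (\<Delta> x) - tmap2 D (mul D x) id (\<delta> y)
            - tmap2 D id (brk D x) (\<Delta> y) - tmap2 D (mul D y) id (\<delta> x)
            - tmap2 D id Q (\<Delta> (mul D x y)) = 0"
  proof (rule tensor_eqI)
    fix f g assume fg: "f \<in> car (dualsp D)" "g \<in> car (dualsp D)"
    have "f (brk D (mul D x y) (R g)) =
        f (mul D x (brk D y (R g))) + f (mul D y (brk D x (R g))) - f (mul D (mul D x y) (der D (R g)))"
      using xy fg by (simp add: adjoint.\<rho>_mul dual_rules all_rules)
    moreover have "g (brk D (mul D x y) (R f)) =
        g (brk D x (mul D y (R f))) + g (brk D y (mul D x (R f))) - g (der D (mul D (mul D x y) (R f)))"
      using xy fg by (simp add: adjoint.\<rho>_mul_dual dual_rules all_rules)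
    moreover have "g (Q z) = - g (der D z)" if "z \<in> car D" for z
      using that fg by (simp add: Q_def dual_rules all_rules)
    ultimately show "(\<delta> (mul D x y) - tmap2 D id (brk D y) (\<Delta> x) - tmap2 D (mul D x) id (\<delta> y)
            - tmap2 D id (brk D x) (\<Delta> y) - tmap2 D (mul D y) id (\<delta> x)
            - tmap2 D id Q (\<Delta> (mul D x y))) f g = 0 f g"
      using xy fg swap(2)[OF y x fg(2,1)] swap(2)[OF x y fg(2,1)]
      by (simp add: eval RQ)
  qed (use xy in \<open>auto simp: off\<close>)
  show "\<Delta> (brk D x y) - tmap2 D (mul D y) id (\<delta> x) - tmap2 D id (brk D x) (\<Delta> y)
            + tmap2 D id (mul D y) (\<delta> x) - tmap2 D (brk D x) id (\<Delta> y)
            + \<Delta> (mul D (der D x) y) = 0"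
  proof (rule tensor_eqI)
    fix f g assume fg: "f \<in> car (dualsp D)" "g \<in> car (dualsp D)"
    have "h (brk D x (mul D y z)) = h (mul D y (brk D x z)) + h (mul D (brk D x y) z) + h (mul D (mul D (der D x) y) z)"
      if "h \<in> car (dualsp D)" "z \<in> car D" for h z
      using that xy mul_comm[of y "der D x"] by (simp add: adjoint.\<rho>_\<sigma> dual_rules all_rules)
    from this[OF fg(1), of "R g"] this[OF fg(2), of "R f"] show "(\<Delta> (brk D x y) - tmap2 D (mul D y) id (\<delta> x) - tmap2 D id (brk D x) (\<Delta> y)
            + tmap2 D id (mul D y) (\<delta> x) - tmap2 D (brk D x) id (\<Delta> y)
            + \<Delta> (mul D (der D x) y)) f g = 0 f g"
      using xy fg swap(2)[OF x y fg] swap(2)[OF x y fg(2,1)] by (simp add: eval)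
  qed (use xy in \<open>auto simp: off\<close>)
qed

abbreviation bow :: "('k, 'v \<times> ('v \<Rightarrow> 'k)) rpa" where
  "bow \<equiv> bowtie D \<Delta> \<delta> Q"

text \<open>
  The coadjoint action of \<open>D\<^sup>*\<close> on \<open>D = D\<^sup>*\<^sup>*\<close> in terms of \<open>R\<close>; the correction
  \<open>R (a \<circ> L\<^sub>y)\<close> is what the shear absorbs.
\<close>
lemma predual_mul:
  assumes a: "a \<in> car (dualsp D)" and y: "y \<in> car D"
  shows "- predual_rep D (mul star) a y = mul D (R a) y - R (dual_map D (mul D y) a)" (is "_ = ?z")
proof -
  have z: "?z \<in> car D" using a y by (simp add: all_rules dual_map_closed)
  have "dual_rep (dualsp D) (mul star) a (ev D y) = ev D (- ?z)"
  proof
    fix g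
    show "dual_rep (dualsp D) (mul star) a (ev D y) g = ev D (- ?z) g"
    proof (cases "g \<in> car (dualsp D)")
      case True
      then have "ev D y (mul star a g) = g (mul D (R a) y) + a (mul D (R g) y)"
        using a y by (simp add: ev_def restr_def star_mul)
      moreover have "g (R (dual_map D (mul D y) a)) = - a (mul D (R g) y)"
        using a y True R_transpose[OF mul_lin[OF y] a True] by (simp add: mul_comm R_rules)
      ultimately show ?thesis
        using True a y
        by (simp add: dual.dual_rep_apply)
          (simp add: ev_def restr_def dual_rules all_rules dual_map_closed)
    qed (simp add: dual_rep_def ev_def restr_def)
  qed
  then have "predual_rep D (mul star) a y = - ?z"
    unfolding predual_rep_def using z by (simp add: unev_ev car_neg del: minus_diff_eq)
  then show ?thesis by simp
qed

lemma predual_brk: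
  assumes a: "a \<in> car (dualsp D)" and y: "y \<in> car D"
  shows "predual_rep D (brk star) a y = brk D (R a) y - R (dual_map D (brk D y) a)" (is "_ = ?z")
proof -
  have z: "?z \<in> car D" using a y by (simp add: all_rules dual_map_closed)
  have "dual_rep (dualsp D) (brk star) a (ev D y) = ev D ?z"
  proof
    fix g
    show "dual_rep (dualsp D) (brk star) a (ev D y) g = ev D ?z g"
    proof (cases "g \<in> car (dualsp D)")
      case True
      then have "ev D y (brk star a g) = a (brk D (R g) y) - g (brk D (R a) y)"
        using a y by (simp add: ev_def restr_def star_brk)
      moreover have "g (R (dual_map D (brk D y) a)) = a (brk D (R g) y)"
        using a y True R_transpose[OF brk_lin[OF y] a True] brk_antisym[of "R g" y]
        by (simp add: all_rules dual_rules)
      ultimately show ?thesis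
        using True a y
        by (simp add: dual.dual_rep_apply)
          (simp add: ev_def restr_def dual_rules all_rules dual_map_closed)
    qed (simp add: dual_rep_def ev_def restr_def)
  qed
  then show ?thesis
    unfolding predual_rep_def using z by (simp add: unev_ev)
qed

text \<open>
  The double \<open>D \<bowtie> D\<^sup>*\<close> is determined by its two subalgebras \<open>D\<close> and \<open>D\<^sup>*\<close> and the invariant pairing;
  in \<open>D \<ltimes> D\<^sup>*\<close> the copy of \<open>D\<^sup>*\<close> is the graph of \<open>R\<close>, so the isomorphism has to send
  \<open>(0, a)\<close> to \<open>(R a, a)\<close>.
\<close>
definition shear :: "'v \<times> ('v \<Rightarrow> 'k) \<Rightarrow> 'v \<times> ('v \<Rightarrow> 'k)" where
  "shear = (\<lambda>(x, a). (x + R a, a))"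

lemma bow_car: "car bow = car D \<times> car (dualsp D)"
  by (simp add: bowtie_def Let_def dual_rpa_def)

lemma bow_fd_space: "fd_space bow"
  by (rule product_fd_space[OF fd_space_axioms dual_fd_space])
    (simp_all add: bowtie_def Let_def dual_rpa_def)

lemma dual_rep_transpose:
  "dual_rep D (mul D) x a = - dual_map D (mul D x) a" "dual_rep D (brk D) x a = - dual_map D (brk D x) a"
  by (auto simp: fun_eq_iff dual_rep_apply dual_map_apply)

lemma star_mul_eq:
  "f \<in> car (dualsp D) \<Longrightarrow> g \<in> car (dualsp D) \<Longrightarrow>
    mul star f g = dual_map D (mul D (R f)) g + dual_map D (mul D (R g)) f"
  using star_mul(2)[of f g] dual_rules(6)[OF star_mul(1)[of f g]]
  by (auto simp: fun_eq_iff dual_map_apply)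

lemma star_brk_eq:
  "f \<in> car (dualsp D) \<Longrightarrow> g \<in> car (dualsp D) \<Longrightarrow>
    brk star f g = dual_map D (brk D (R g)) f - dual_map D (brk D (R f)) g"
  using star_brk(2)[of f g] dual_rules(6)[OF star_brk(1)[of f g]]
  by (auto simp: fun_eq_iff dual_map_apply)

lemma dual_map_add_left:
  assumes "x \<in> car D" "y \<in> car D" "f \<in> car (dualsp D)"
  shows "dual_map D (mul D (x + y)) f = dual_map D (mul D x) f + dual_map D (mul D y) f"
    and "dual_map D (brk D (x + y)) f = dual_map D (brk D x) f + dual_map D (brk D y) f"
  using assms by (auto simp: fun_eq_iff dual_map_apply all_rules dual_rules)

lemma shear_lin: "lin_map bow double shear"
  by (auto simp: lin_map_def bow_car)
    (auto simp: shear_def bowtie_def Let_def dual_rpa_def double_def semidirect_def all_rules)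

lemma shear_inj: "inj_on shear (car bow)"
  by (auto simp: inj_on_def shear_def)

lemma shear_mul:
  assumes "u \<in> car bow" "v \<in> car bow"
  shows "mul bow u v \<in> car bow \<and> shear (mul bow u v) = mul double (shear u) (shear v)"
proof -
  obtain x a y b where uv: "u = (x, a)" "v = (y, b)"
    and c: "x \<in> car D" "a \<in> car (dualsp D)" "y \<in> car D" "b \<in> car (dualsp D)"
    using assms by (auto simp: bow_car)
  have mul: "mul bow u v =
      (mul D x y + (mul D (R a) y - R (dual_map D (mul D y) a)) + (mul D (R b) x - R (dual_map D (mul D x) b)),
       mul star a b + dual_map D (mul D x) b + dual_map D (mul D y) a)"
    using c predual_mul[of a y, symmetric] predual_mul[of b x, symmetric]
    by (simp add: bowtie_def Let_def uv dual_rep_transpose)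
  have image: "R (dual_map D (mul D (R a)) b) + R (dual_map D (mul D (R b)) a) = mul D (R a) (R b)"
    using star_mul(3)[of a b] c by (simp only: star_mul_eq) (simp add: R_rules dual_map_closed)
  show ?thesis
    unfolding mul bow_car using c mul_comm[of "R b" x]
    by (simp add: all_rules dual_map_closed star_mul dual.car_rules)
      (simp add: uv shear_def double_def semidirect_def dual_rep_transpose all_rules dual.car_rules
        star_mul dual_map_closed dual_map_add_left star_mul_eq add_ac image)
qed

lemma shear_brk:
  assumes "u \<in> car bow" "v \<in> car bow"
  shows "brk bow u v \<in> car bow \<and> shear (brk bow u v) = brk double (shear u) (shear v)"
proof -
  obtain x a y b where uv: "u = (x, a)" "v = (y, b)"
    and c: "x \<in> car D" "a \<in> car (dualsp D)" "y \<in> car D" "b \<in> car (dualsp D)"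
    using assms by (auto simp: bow_car)
  have brk: "brk bow u v =
      (brk D x y + (brk D (R a) y - R (dual_map D (brk D y) a)) - (brk D (R b) x - R (dual_map D (brk D x) b)),
       brk star a b - dual_map D (brk D x) b + dual_map D (brk D y) a)"
    using c predual_brk[of a y] predual_brk[of b x]
    by (simp add: bowtie_def Let_def uv dual_rep_transpose)
  have image: "R (dual_map D (brk D (R b)) a) - R (dual_map D (brk D (R a)) b) = brk D (R a) (R b)"
    using star_brk(3)[of a b] c by (simp only: star_brk_eq) (simp add: R_rules dual_map_closed)
  show ?thesis
    unfolding brk bow_car using c brk_antisym[of "R b" x]
    by (simp add: all_rules dual_map_closed star_brk dual.car_rules)
      (simp add: uv shear_def double_def semidirect_def dual_rep_transpose all_rules dual.car_rules
        star_brk dual_map_closed dual_map_add_left star_brk_eq image)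
qed

lemma shear_der:
  assumes "u \<in> car bow"
  shows "der bow u \<in> car bow \<and> shear (der bow u) = der double (shear u)"
proof -
  obtain x a where u: "u = (x, a)" and c: "x \<in> car D" "a \<in> car (dualsp D)"
    using assms by (auto simp: bow_car)
  have der: "der bow u = (der D x, der star a)" by (simp add: bowtie_def Let_def u)
  show ?thesis
    using c star_der[OF c(2)]
    by (simp add: der bow_car all_rules) (simp add: u shear_def double_def semidirect_def all_rules)
qed

lemma bow_rpa: "relative_poisson_algebra bow"
  by (rule relative_poisson_algebra_embedding[OF bow_fd_space double_rpa shear_lin shear_inj
        shear_mul shear_brk shear_der])

lemma shear_pairing:
  "u \<in> car bow \<Longrightarrow> v \<in> car bow \<Longrightarrow> pairing_form (shear u) (shear v) = pairing_form u v"
  using R_skew[of "snd u" "snd v"]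
  by (auto simp: pairing_form_def shear_def bow_car dual_rules R_rules)

text \<open>
  Both sides of the first claim are \<open>c (x \<cdot> y) + b (x \<cdot> z) + a (y \<cdot> z)\<close> for the three arguments
  \<open>(x, a)\<close>, \<open>(y, b)\<close>, \<open>(z, c)\<close>.
\<close>
lemma double_invariant:
  assumes "u \<in> car double" "v \<in> car double" "w \<in> car double"
  shows "pairing_form (mul double u v) w = pairing_form u (mul double v w)"
    and "pairing_form (brk double u v) w = pairing_form u (brk double v w)"
proof -
  obtain x a y b z c where uvw: "u = (x, a)" "v = (y, b)" "w = (z, c)"
    and car: "x \<in> car D" "a \<in> car (dualsp D)" "y \<in> car D" "b \<in> car (dualsp D)"
      "z \<in> car D" "c \<in> car (dualsp D)"
    using assms by (auto simp: double_def semidirect_def)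
  show "pairing_form (mul double u v) w = pairing_form u (mul double v w)"
    using car mul_comm[of z x] 
    by (simp add: uvw double_def semidirect_def pairing_form_def dual_rep_apply mul_comm)
  show "pairing_form (brk double u v) w = pairing_form u (brk double v w)"
    using car brk_antisym[of y x] brk_antisym[of z x]
    by (simp add: uvw double_def semidirect_def pairing_form_def dual_rep_apply dual_rules all_rules)
qed

lemma bow_unit:
  assumes u: "is_unit D u" shows "is_unit bow (u, 0)"
proof -
  interpret bow: relative_poisson_algebra bow by (rule bow_rpa)
  have uc: "u \<in> car D" and unit: "\<And>x. x \<in> car D \<Longrightarrow> mul D u x = x" "\<And>x. x \<in> car D \<Longrightarrow> mul D x u = x"
    using u by (auto simp: is_unit_def)
  have c: "(u, 0) \<in> car bow" by (simp add: bow_car uc dual.car_zero)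
  have "mul bow (u, 0) v = v" if v: "v \<in> car bow" for v
  proof (rule inj_onD[OF shear_inj])
    show "shear (mul bow (u, 0) v) = shear v"
      using v shear_mul[OF c v]
      by (auto simp: bow_car shear_def double_def semidirect_def unit all_rules)
        (auto simp: fun_eq_iff dual_rep_apply dual_rules unit)
  qed (use v c bow.mul_rules(1) in auto)
  then show ?thesis using c bow.mul_comm by (simp add: is_unit_def)
qed

text \<open>
  Invariance is pulled back along the shear, which is an isometry; nondegeneracy holds for the
  pairing of any finite-dimensional space with its dual.
\<close>
lemma bow_frobenius:
  assumes u: "is_unit D u"
  shows "frobenius_jacobi_algebra bow (u, 0) pairing_form"
proof -
  interpret bow: relative_poisson_algebra bow by (rule bow_rpa)
  have shear_in: "shear v \<in> car double" if "v \<in> car bow" for v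
    using shear_lin that by (simp add: lin_map_def)
  show ?thesis
  proof (intro frobenius_jacobi_algebra.intro frobenius_jacobi_algebra_axioms.intro)
    show "jacobi_algebra bow (u, 0)" by (rule bow.unital_jacobi[OF bow_unit[OF u]])
    show "bilin_map bow ground pairing_form"
      by (auto simp: bilin_map_def lin_map_def bow_car)
        (auto simp: bowtie_def Let_def dual_rpa_def ground_def pairing_form_def dual_rules all_rules
          dualsp_def[THEN arg_cong[of _ _ scl]] algebra_simps)
    fix v w assume v: "v \<in> car bow" and w: "w \<in> car bow"
    show "pairing_form v w = pairing_form w v"
      by (auto simp: pairing_form_def add.commute split: prod.splits)
    fix z assume z: "z \<in> car bow"
    note inv = shear_mul shear_brk shear_in v w z bow.mul_rules(1)
      bow.brk_rules(1) double_invariant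
    show "pairing_form (mul bow v w) z = pairing_form v (mul bow w z)"
      "pairing_form (brk bow v w) z = pairing_form v (brk bow w z)"
      using shear_pairing[of "mul bow v w" z] shear_pairing[of v "mul bow w z"]
        shear_pairing[of "brk bow v w" z] shear_pairing[of v "brk bow w z"]
      by (simp_all add: inv)
  next
    fix v assume v: "v \<in> car bow" and zero: "\<And>w. w \<in> car bow \<Longrightarrow> pairing_form v w = 0"
    obtain x a where xa: "v = (x, a)" "x \<in> car D" "a \<in> car (dualsp D)"
      using v by (auto simp: bow_car)
    have "x = 0"
    proof (rule dual_separates)
      fix f assume "f \<in> car (dualsp D)"
      then show "f x = f 0"
        using zero[of "(0, f)"] xa by (simp add: bow_car car_zero pairing_form_def dual_rules)
    qed (simp_all add: xa car_zero)
    moreover have "a = 0"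
    proof (rule dual_eqI)
      fix y assume "y \<in> car D"
      then show "a y = 0 y"
        using zero[of "(y, 0)"] xa by (simp add: bow_car dual.car_zero pairing_form_def)
    qed (simp_all add: xa dual.car_zero)
    ultimately show "v = 0" by (simp add: xa zero_prod_def)
  qed
qed

end

section \<open>The operator of a relative pre-Poisson algebra\<close>

text \<open>A basis and its dual basis, given by the expansion of vectors in dual coordinates.\<close>
locale pre_poisson_basis = relative_pre_poisson_algebra A
  for A :: "('k::field, 'v::ab_group_add, 'm) rppa_scheme" +
  fixes I :: "'i set" and e :: "'i \<Rightarrow> 'v" and e' :: "'i \<Rightarrow> 'v \<Rightarrow> 'k"
  assumes e_in: "i \<in> I \<Longrightarrow> e i \<in> car A"
    and e'_in: "i \<in> I \<Longrightarrow> e' i \<in> car (dualsp A)"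
    and expansion: "x \<in> car A \<Longrightarrow> x = (\<Sum>i\<in>I. scl A (e' i x) (e i))"
begin

sublocale dual: fd_space "dualsp A" by (rule dual_fd_space)

definition D :: "('k, ('v \<times> 'k) \<times> ('v \<Rightarrow> 'k)) rpa" where
  "D = semidirect (unit_ext (subadjacent A)) (dualsp A)
     (\<lambda>x u. - dual_rep A (zin_ext A) x u) (dual_rep A (prl_ext A)) (\<lambda>u. - dual_map A (pder A) u)"

lemma D_rpa: "relative_poisson_algebra D"
proof -
  interpret L: rpa_representation "subadjacent A" A "zin A" "prl A" "pder A"
    by (rule left_multiplication_representation)
  interpret L_ext: rpa_representation "unit_ext (subadjacent A)" A "zin_ext A" "prl_ext A" "pder A"
    unfolding zin_ext_def prl_ext_def by (rule L.unit_ext_representation)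
  interpret L_dual: rpa_representation "unit_ext (subadjacent A)" "dualsp A"
    "\<lambda>x u. - dual_rep A (zin_ext A) x u" "dual_rep A (prl_ext A)" "\<lambda>u. - dual_map A (pder A) u"
    by (rule L_ext.dual_representation)
  show ?thesis unfolding D_def by (rule L_dual.semidirect_rpa)
qed

sublocale D: relative_poisson_algebra D by (rule D_rpa)

lemmas D_ops = D_def semidirect_def unit_ext_def subadjacent_def

lemma D_car: "car D = (car A \<times> UNIV) \<times> car (dualsp A)"
  by (simp add: D_ops)

lemma D_unit: "is_unit D ((0, 1), 0)"
  unfolding is_unit_def
proof (intro conjI ballI)
  show c: "((0, 1), 0) \<in> car D" by (simp add: D_car car_zero dual.car_zero)
  fix z assume z: "z \<in> car D"
  show "mul D ((0, 1), 0) z = z"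
    using z
    by (auto simp: D_car)
      (auto simp: D_ops zin_rules vector_space_rules fun_eq_iff dual_rep_apply zin_ext_def dual_rules)
  then show "mul D z ((0, 1), 0) = z" using D.mul_comm[OF c z] by simp
qed

text \<open>
  The restrictions of a functional on \<open>(A \<oplus> K e) \<oplus> A\<^sup>*\<close> to \<open>A\<close> and to \<open>A\<^sup>*\<close>, the latter
  regarded as an element of \<open>A\<close> (see \<open>functional_right\<close>). Together they carry all
  that \<open>r\<close> sees of a functional, as \<open>r\<close> has no component along \<open>e\<close>.
\<close>
definition \<alpha> :: "(('v \<times> 'k) \<times> ('v \<Rightarrow> 'k) \<Rightarrow> 'k) \<Rightarrow> 'v \<Rightarrow> 'k" where
  "\<alpha> f = restr A (\<lambda>a. f ((a, 0), 0))"

definition \<beta> :: "(('v \<times> 'k) \<times> ('v \<Rightarrow> 'k) \<Rightarrow> 'k) \<Rightarrow> 'v" where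
  "\<beta> f = (\<Sum>i\<in>I. scl A (f (0, e' i)) (e i))"

definition R :: "(('v \<times> 'k) \<times> ('v \<Rightarrow> 'k) \<Rightarrow> 'k) \<Rightarrow> ('v \<times> 'k) \<times> ('v \<Rightarrow> 'k)" where
  "R f = ((- \<beta> f, 0), \<alpha> f)"

lemma \<beta>_in: "\<beta> f \<in> car A"
  unfolding \<beta>_def by (intro car_sum car_scl e_in)

lemma functional_parts:
  assumes f: "f \<in> car (dualsp D)"
  shows "\<alpha> f \<in> car (dualsp A)"
    and "a \<in> car A \<Longrightarrow> u \<in> car (dualsp A) \<Longrightarrow> f ((a, 0), u) = \<alpha> f a + u (\<beta> f)"
proof -
  note lin = D.dual_rules(1,2)[OF f]
  have split: "f ((a, 0), u) = f ((a, 0), 0) + f (0, u)" if "a \<in> car A" "u \<in> car (dualsp A)" for a u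
    using lin(1)[of "((a, 0), 0)" "(0, u)"] that
    by (simp add: D_car zero_prod_def car_zero dual.car_zero)
  have left: "f ((a + b, 0), 0) = f ((a, 0), 0) + f ((b, 0), 0)"
    "f ((scl A c a, 0), 0) = c * f ((a, 0), 0)" if "a \<in> car A" "b \<in> car A" for a b c
    using lin(1)[of "((a, 0), 0)" "((b, 0), 0)"] lin(2)[of "((a, 0), 0)" c] that
    by (simp_all add: D_car car_zero dual.car_zero)
      (simp add: D_ops dual.vector_space_rules)
  show "\<alpha> f \<in> car (dualsp A)"
    unfolding \<alpha>_def by (rule restr_in_dual) (simp add: lin_map_def ground_def left)
  have right: "f (0, u + v) = f (0, u) + f (0, v)" "f (0, scl (dualsp A) c u) = c * f (0, u)"
    if "u \<in> car (dualsp A)" "v \<in> car (dualsp A)" for u v c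
    using lin(1)[of "(0, u)" "(0, v)"] lin(2)[of "(0, u)" c] that
    by (simp_all add: D_car car_zero dual.car_zero zero_prod_def)
      (simp add: D_ops vector_space_rules)
  have "lin_map (dualsp A) ground (\<lambda>u. f (0, u))"
    by (simp add: lin_map_def ground_def right)
  note sum = dual.lin_map_sum[OF this]
  have "f (0, u) = u (\<beta> f)" if u: "u \<in> car (dualsp A)" for u
  proof -
    have "u = (\<Sum>i\<in>I. scl (dualsp A) (u (e i)) (e' i))"
    proof (rule dual_eqI)
      fix x assume x: "x \<in> car A"
      have app: "(\<Sum>i\<in>J. scl (dualsp A) (u (e i)) (e' i)) x = (\<Sum>i\<in>J. u (e i) * e' i x)" for J
        by (induction J rule: infinite_finite_induct) (auto simp: dualsp_def)
      have "u x = u (\<Sum>i\<in>I. scl A (e' i x) (e i))" using expansion[OF x] by simp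
      also have "\<dots> = (\<Sum>i\<in>I. u (e i) * e' i x)"
        by (subst dual_sum[OF u]) (auto simp: car_scl e_in dual_rules[OF u] mult.commute intro!: sum.cong)
      finally show "u x = (\<Sum>i\<in>I. scl (dualsp A) (u (e i)) (e' i)) x" by (simp add: app)
    qed (use u in \<open>auto intro: dual.car_sum dual.car_scl e'_in\<close>)
    then have "f (0, u) = f (0, \<Sum>i\<in>I. scl (dualsp A) (u (e i)) (e' i))" by simp
    also have "\<dots> = (\<Sum>i\<in>I. u (e i) * f (0, e' i))"
      by (subst sum) (auto simp: dual.car_scl e'_in right(2)[of _ 0] dual.car_zero intro!: sum.cong)
    also have "\<dots> = u (\<beta> f)"
      unfolding \<beta>_def
      by (subst dual_sum[OF u]) (auto simp: car_scl e_in dual_rules[OF u] mult.commute intro!: sum.cong)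
    finally show ?thesis .
  qed
  then show "a \<in> car A \<Longrightarrow> u \<in> car (dualsp A) \<Longrightarrow> f ((a, 0), u) = \<alpha> f a + u (\<beta> f)"
    by (simp add: split \<alpha>_def restr_apply)
qed

lemma functional_right:
  "f \<in> car (dualsp D) \<Longrightarrow> u \<in> car (dualsp A) \<Longrightarrow> u (\<beta> f) = f (0, u)"
  using functional_parts(1)[of f] functional_parts(2)[of f 0 u] by (simp add: car_zero zero_prod_def dual_rules)

lemma functional_R:
  assumes "f \<in> car (dualsp D)" "g \<in> car (dualsp D)"
  shows "g (R f) = \<alpha> f (\<beta> g) - \<alpha> g (\<beta> f)"
  using assms by (simp add: R_def functional_parts \<beta>_in car_neg dual_rules[OF functional_parts(1)])

lemma R_lin: "lin_map (dualsp D) D R"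
  unfolding lin_map_def
proof (intro conjI ballI allI)
  interpret DD: fd_space "dualsp D" by (rule D.dual_fd_space)
  fix f g c assume f: "f \<in> car (dualsp D)" and g: "g \<in> car (dualsp D)"
  show "R f \<in> car D" by (simp add: R_def D_car functional_parts f car_neg \<beta>_in)
  have "\<beta> (f + g) = \<beta> f + \<beta> g"
    by (rule dual_separates)
      (simp_all add: \<beta>_in car_add dual_rules functional_right f g DD.car_add)
  then show "R (f + g) = R f + R g"
    by (auto simp: R_def \<alpha>_def restr_def)
  have "\<beta> (scl (dualsp D) c f) = scl A c (\<beta> f)"
    by (rule dual_separates)
      (simp_all add: \<beta>_in car_scl dual_rules functional_right f DD.car_scl, simp add: dualsp_def)
  then show "R (scl (dualsp D) c f) = scl D c (R f)"
    by (auto simp: R_def D_ops \<alpha>_def restr_def vector_space_rules)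
      (auto simp: dualsp_def fun_eq_iff)
qed

text \<open>
  Since \<open>\<beta>\<close>-parts lie in \<open>A\<close> and \<open>\<alpha>\<close>-parts in the abelian ideal \<open>A\<^sup>*\<close>, each cyclic sum is linear in
  the \<open>\<alpha>\<close>-parts. In the first one \<open>\<alpha> h\<close> is applied to \<open>\<beta> f \<cdot> \<beta> g\<close> minus
  \<open>\<beta> f \<star> \<beta> g + \<beta> g \<star> \<beta> f\<close>, and likewise with the commutator of \<open>\<circ>\<close>.
\<close>
lemma R_operator: "rpybe_operator D R"
proof (intro rpybe_operator.intro rpybe_operator_axioms.intro)
  show "relative_poisson_algebra D" "lin_map (dualsp D) D R" by (fact D_rpa R_lin)+
  note rules = zin_rules prl_rules pder_rules car_rules vector_space_rules \<beta>_in
  have R_in: "f \<in> car (dualsp D) \<Longrightarrow> R f \<in> car D" for f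
    using R_lin by (simp add: lin_map_def)
  fix f assume f: "f \<in> car (dualsp D)"
  show "R (dual_map D (der D) f) = - der D (R f)"
  proof -
    let ?k = "dual_map D (der D) f"
    have k: "?k \<in> car (dualsp D)" by (rule D.dual_map_in_dual[OF D.der_lin f])
    have k_apply: "?k z = f (der D z)" if "z \<in> car D" for z
      using that by (simp add: D.dual_map_apply)
    have transpose: "- dual_map A (pder A) u \<in> car (dualsp A)" if "u \<in> car (dualsp A)" for u
      using dual.car_neg[OF dual_map_in_dual[OF pder_lin that]] .
    have "\<alpha> ?k = dual_map A (pder A) (\<alpha> f)"
    proof (rule dual_eqI)
      fix a assume a: "a \<in> car A"
      have "dual_map A (pder A) 0 = 0" by (auto simp: fun_eq_iff dual_map_apply)
      then have "\<alpha> ?k a = f ((pder A a, 0), 0)"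
        using a by (simp add: \<alpha>_def restr_apply k_apply D_car dual.car_zero) (simp add: D_ops)
      then show "\<alpha> ?k a = dual_map A (pder A) (\<alpha> f) a"
        using a by (simp add: \<alpha>_def restr_apply dual_map_apply rules)
    qed (simp_all add: functional_parts k f dual_map_in_dual pder_lin)
    moreover have "\<beta> ?k = - pder A (\<beta> f)"
    proof (rule dual_separates)
      fix u assume u: "u \<in> car (dualsp A)"
      have "u (\<beta> ?k) = f (0, - dual_map A (pder A) u)"
        using u by (simp add: functional_right k k_apply D_car rules zero_prod_def)
          (simp add: D_ops rules)
      also have "\<dots> = (- dual_map A (pder A) u) (\<beta> f)"
        using functional_right[OF f transpose[OF u]] by simp
      finally show "u (\<beta> ?k) = u (- pder A (\<beta> f))"
        using u by (simp add: dual_map_apply dual_rules rules)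
    qed (simp_all add: rules)
    ultimately show ?thesis
      by (simp add: R_def) (simp add: D_ops rules)
  qed
  fix g assume g: "g \<in> car (dualsp D)"
  show "g (R f) = - f (R g)"
    by (simp add: functional_R f g)
  fix h assume h: "h \<in> car (dualsp D)"
  show "f (mul D (R g) (R h)) + g (mul D (R h) (R f)) + h (mul D (R f) (R g)) = 0"
  proof -
    have mul: "f (mul D (R g) (R h)) = \<alpha> f (zin A (\<beta> g) (\<beta> h) + zin A (\<beta> h) (\<beta> g))
        - \<alpha> h (zin A (\<beta> g) (\<beta> f)) - \<alpha> g (zin A (\<beta> h) (\<beta> f))"
      if "f \<in> car (dualsp D)" "g \<in> car (dualsp D)" "h \<in> car (dualsp D)" for f g h
    proof -
      let ?w = "snd (mul D (R g) (R h))"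
      have "mul D (R g) (R h) \<in> car D"
        using that R_in by (intro D.mul_rules(1))
      then have w: "?w \<in> car (dualsp A)" by (auto simp: D_car)
      have "mul D (R g) (R h) = ((zin A (\<beta> g) (\<beta> h) + zin A (\<beta> h) (\<beta> g), 0), ?w)"
        by (simp add: D_ops R_def rules)
      then have "f (mul D (R g) (R h)) =
          \<alpha> f (zin A (\<beta> g) (\<beta> h) + zin A (\<beta> h) (\<beta> g)) + ?w (\<beta> f)"
        using functional_parts(2)[OF that(1) _ w] by (metis \<beta>_in car_add zin_rules(1))
      moreover have "?w (\<beta> f) = - \<alpha> h (zin A (\<beta> g) (\<beta> f)) - \<alpha> g (zin A (\<beta> h) (\<beta> f))"
        using that by (simp add: D_ops R_def rules dual_rep_apply zin_ext_def
            dual_rules[OF functional_parts(1)])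
      ultimately show ?thesis by simp
    qed
    show ?thesis
      by (simp add: mul f g h dual_rules[OF functional_parts(1)] rules)
  qed
  show "f (brk D (R g) (R h)) + g (brk D (R h) (R f)) + h (brk D (R f) (R g)) = 0"
  proof -
    have brk: "f (brk D (R g) (R h)) = \<alpha> f (prl A (\<beta> g) (\<beta> h) - prl A (\<beta> h) (\<beta> g))
        + \<alpha> h (prl A (\<beta> g) (\<beta> f)) - \<alpha> g (prl A (\<beta> h) (\<beta> f))"
      if "f \<in> car (dualsp D)" "g \<in> car (dualsp D)" "h \<in> car (dualsp D)" for f g h
    proof -
      let ?w = "snd (brk D (R g) (R h))"
      have "brk D (R g) (R h) \<in> car D"
        using that R_in by (intro D.brk_rules(1))
      then have w: "?w \<in> car (dualsp A)" by (auto simp: D_car)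
      have "brk D (R g) (R h) = ((prl A (\<beta> g) (\<beta> h) - prl A (\<beta> h) (\<beta> g), 0), ?w)"
        by (simp add: D_ops R_def rules)
      then have "f (brk D (R g) (R h)) =
          \<alpha> f (prl A (\<beta> g) (\<beta> h) - prl A (\<beta> h) (\<beta> g)) + ?w (\<beta> f)"
        using functional_parts(2)[OF that(1) _ w] by (metis \<beta>_in car_diff prl_rules(1))
      moreover have "?w (\<beta> f) = \<alpha> h (prl A (\<beta> g) (\<beta> f)) - \<alpha> g (prl A (\<beta> h) (\<beta> f))"
        using that by (simp add: D_ops R_def rules dual_rep_apply prl_ext_def
            dual_rules[OF functional_parts(1)])
      ultimately show ?thesis by simp
    qed
    show ?thesis
      by (simp add: brk f g h dual_rules[OF functional_parts(1)] rules)
  qed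
qed

sublocale R: rpybe_operator D R by (rule R_operator)

lemma tensor_eq:
  "(\<Sum>i\<in>I. pure2 D ((e i, 0), 0) (0, e' i) - pure2 D (0, e' i) ((e i, 0), 0)) = R.tensor"
proof (intro ext)
  fix f g
  have app: "(\<Sum>i\<in>J. t i) f g = (\<Sum>i\<in>J. t i f g)"
    for J and t :: "'i \<Rightarrow> ('k, ('v \<times> 'k) \<times> ('v \<Rightarrow> 'k)) tensor2"
    by (induction J rule: infinite_finite_induct) auto
  show "(\<Sum>i\<in>I. pure2 D ((e i, 0), 0) (0, e' i) - pure2 D (0, e' i) ((e i, 0), 0)) f g = R.tensor f g"
  proof (cases "f \<in> car (dualsp D) \<and> g \<in> car (dualsp D)")
    case True
    have part: "\<alpha> f (\<beta> g) = (\<Sum>i\<in>I. f ((e i, 0), 0) * g (0, e' i))"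
      if "f \<in> car (dualsp D)" "g \<in> car (dualsp D)" for f g
      unfolding \<beta>_def using dual_rules[OF functional_parts(1)[OF that(1)]]
      by (subst dual_sum[OF functional_parts(1)[OF that(1)]])
        (auto simp: car_scl e_in \<alpha>_def restr_apply mult.commute intro!: sum.cong)
    show ?thesis
      using True
      by (simp add: R.tensor_apply functional_R part app pure2_def ext2_def sum_subtractf mult.commute)
  qed (auto simp: app pure2_def ext2_def R.tensor_def)
qed

end

theorem theorem5p8:
  fixes A :: "('k::{alg_closed_field, field_char_0}, 'v::ab_group_add) rppa"
    and n :: nat
    and e :: "nat \<Rightarrow> 'v"
    and e' :: "nat \<Rightarrow> 'v \<Rightarrow> 'k"
  assumes "relative_pre_poisson_algebra A"
    and "inj_on e {1..n}"
    and "\<not> module.dependent (scl A) (e ` {1..n})"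
    and "module.span (scl A) (e ` {1..n}) = car A"
    and "\<And>i. i \<in> {1..n} \<Longrightarrow> e' i \<in> car (dualsp A)"
    and "\<And>i j. i \<in> {1..n} \<Longrightarrow> j \<in> {1..n} \<Longrightarrow> e' i (e j) = (if i = j then 1 else 0)"
  shows
    "let P = pder A;
         A\<^sub>e = unit_ext (subadjacent A);
         D = semidirect A\<^sub>e (dualsp A)
               (\<lambda>x u. - dual_rep A (zin_ext A) x u)
               (dual_rep A (prl_ext A))
               (\<lambda>u. - dual_map A P u);
         Q = map_prod (\<lambda>x. - der A\<^sub>e x) (dual_map A P);
         r = (\<Sum>i\<in>{1..n}. pure2 D ((e i, 0), 0) (0, e' i) - pure2 D (0, e' i) ((e i, 0), 0));
         \<Delta> = (\<lambda>u. tmap2 D id (mul D u) r - tmap2 D (mul D u) id r);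
         \<delta> = (\<lambda>u. tmap2 D (brk D u) id r + tmap2 D id (brk D u) r)
     in relative_poisson_algebra D \<and> unital D \<and>
        antisymmetric r \<and> rpybe_solution D Q r \<and>
        relative_poisson_bialgebra D \<Delta> \<delta> Q \<and>
        relative_poisson_algebra (bowtie D \<Delta> \<delta> Q) \<and>
        (\<exists>u. frobenius_jacobi_algebra (bowtie D \<Delta> \<delta> Q) u pairing_form)"
proof -
  interpret A: relative_pre_poisson_algebra A by fact
  have e_in: "e i \<in> car A" if "i \<in> {1..n}" for i
  proof -
    interpret vector_space "scl A" by (rule A.ambient)
    show ?thesis using assms(4) span_superset[of "e ` {1..n}"] that by blast
  qed
  interpret pre_poisson_basis A "{1..n}" e e'
    by unfold_locales
      (use e_in assms(5) A.dual_basis_expansion[OF assms(2) _ assms(4-6)] in auto)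
  have Q: "map_prod (\<lambda>x. - der (unit_ext (subadjacent A)) x) (dual_map A (pder A)) = R.Q"
    unfolding R.Q_def by (auto simp: fun_eq_iff D_def semidirect_def)
  have \<Delta>: "(\<lambda>u. tmap2 D id (mul D u) R.tensor - tmap2 D (mul D u) id R.tensor) = R.\<Delta>"
    and \<delta>: "(\<lambda>u. tmap2 D (brk D u) id R.tensor + tmap2 D id (brk D u) R.tensor) = R.\<delta>"
    unfolding R.\<Delta>_def R.\<delta>_def by (rule refl)+
  show ?thesis
    unfolding Let_def D_def[symmetric] Q tensor_eq \<Delta> \<delta>
    using D_rpa D_unit R.antisymmetric_tensor R.tensor_rpybe R.bialgebra R.bow_rpa
      R.bow_frobenius[OF D_unit]
    unfolding unital_def by blast
qed

end
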